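(* Let $X$ be an integral scheme of characteristic $p>0$ and let $\mathcal{D}$ be any Cartier subalgebra on $X$. Then the log discrepancy function $A(-;\mathcal{D}):X^\beth\to[-\infty,\infty]$ is lower-semicontinuous on $X^\beth$, i.e. for every $a\in\mathbb{R}$ the set $\{\zeta\in X^\beth: A(\zeta;\mathcal{D})>a\}$ is open.
   Context: Schemes are separated and noetherian. Let $L$ be the function field of $X$. **The $\beth$-space.** $X^\beth$ is the set of pairs $\zeta=(w,x)$ with $x\in X$ and $w$ a real-valued valuation (values in $\mathbb{R}\cup\{+\infty\}$, possibly trivial) on $\kappa(x)$, centered on $X$, i.e. non-negative on a local ring $\mathcal{O}_{Z,z}$ of $Z=\overline{\{x\}}$ (reduced structure). For $f\in\mathcal{O}_{X,x}$, $\zeta(f)=w(f(x))$ where $f(x)\in\kappa(x)$ is the residue. The home of $\zeta$ is $x$; the center $c_X(\zeta)$ is the point $z\in Z$ such that the valuation ring of $w$ dominates $\mathcal{O}_{Z,z}$. $\mathrm{Val}_X$ denotes the semivaluations whose home is the generic point. If $X=\mathrm{Spec}(R)$, $X^\beth$ has the weakest topology making all maps $\zeta\mapsto\zeta(f)\in[0,\infty]$, $f\in R$, continuous. In general, $\mathcal{U}\subseteq X^\beth$ is open iff $\mathcal{U}\cap V^\beth$ is open in $V^\beth$ for each affine open $V\subseteq X$ (here $V^\beth$ is identified with the $\zeta\in X^\beth$ having center in $V$). **Cartier algebras.** A $p^{-e}$-linear map on $L$ is an additive $\psi:L\to L$ with $\psi(f^{p^e}g)=f\psi(g)$; it is a $p^{-e}$-linear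 map on $X$ if $\psi(\mathcal{O}_X)\subseteq\mathcal{O}_X$. $\mathcal{C}^X=\bigoplus_{e\ge0}\mathcal{C}^X_e$ is the sheaf of graded rings of $p^{-e}$-linear maps on open subsets of $X$, with composition as product, $\mathcal{C}^X_0=\mathcal{O}_X$. A Cartier subalgebra is a quasi-coherent sheaf of graded subrings $\mathcal{D}=\bigoplus\mathcal{D}_e\subseteq\mathcal{C}^X$ with $\mathcal{D}_0=\mathcal{O}_X$. **Log discrepancies.** For a nonzero $p^{-e}$-linear $\psi:L\to L$ ($e\ge1$), $0\ne f\in L$, $v\in\mathrm{Val}_X$: $E(f,\psi,v)=\frac{v(f)-p^ev(\psi(f))}{p^e-1}$, $A(v;\psi)=\sup_{f\neq0,n\ge1}E(f,\psi^n,v)$, and $A(v;\mathcal{D})=\sup_{e\ge1}\sup_{0\ne\psi\in(\mathcal{D}_e)_x}A(v;\psi)$ with $x=c_X(v)$ (and $\sup\varnothing=-\infty$). A closed integral subscheme $Z\subseteq X$ with ideal $\mathcal{I}_Z$ is uniformly $\mathcal{D}$-compatible if $\psi(\mathcal{I}_{Z,x})\subseteq\mathcal{I}_{Z,x}$ for all $x\in X$, $e\ge1$, $\psi\in(\mathcal{D}_e)_x$; then each $\psi$ induces a $p^{-e}$-linear map $\psi\|_Z$ on $Z$, and these form a Cartier subalgebra $\mathcal{D}\|_Z$ on $Z$. For $\zeta\in X^\beth$ with home $x$ and $Z=\overline{\{x\}}$, $A(\zeta;\mathcal{D}):=A(\zeta;\mathcal{D}\|_Z)$ (viewing $\zeta\in\mathrm{Val}_Z$)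 if $Z$ is uniformly $\mathcal{D}$-compatible, and $A(\zeta;\mathcal{D}):=+\infty$ otherwise. *)

theory Defs
  imports "HOL-Analysis.Analysis" "HOL-Algebra.QuotRing" "HOL-Algebra.Ring_Divisibility" "HOL-Algebra.Generated_Rings"
begin

section \<open>Ringed spaces and schemes\<close>

record ('a, 'r) ringed_space =
  top_of :: "'a topology"
  sections :: "'a set \<Rightarrow> 'r ring"
  res :: "'a set \<Rightarrow> 'a set \<Rightarrow> 'r \<Rightarrow> 'r"  \<comment> \<open>\<open>res X U V\<close> restricts sections over \<open>U\<close> to \<open>V \<subseteq> U\<close>\<close>

abbreviation (input) points :: "('a, 'r) ringed_space \<Rightarrow> 'a set" where
  "points X \<equiv> topspace (top_of X)"

abbreviation (input) open_in :: "('a, 'r) ringed_space \<Rightarrow> 'a set \<Rightarrow> bool" where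
  "open_in X U \<equiv> openin (top_of X) U"

definition presheaf_of_rings :: "('a, 'r) ringed_space \<Rightarrow> bool" where
  "presheaf_of_rings X \<longleftrightarrow>
     (\<forall>U. open_in X U \<longrightarrow> cring (sections X U)) \<and>
     (\<forall>U V. open_in X U \<longrightarrow> open_in X V \<longrightarrow> V \<subseteq> U \<longrightarrow>
        res X U V \<in> ring_hom (sections X U) (sections X V)) \<and>
     (\<forall>U. open_in X U \<longrightarrow> (\<forall>s \<in> carrier (sections X U). res X U U s = s)) \<and>
     (\<forall>U V W. open_in X U \<longrightarrow> open_in X V \<longrightarrow> open_in X W \<longrightarrow> W \<subseteq> V \<longrightarrow> V \<subseteq> U \<longrightarrow>
        (\<forall>s \<in> carrier (sections X U). res X V W (res X U V s) = res X U W s))"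

text \<open>The empty family is an allowed cover of the empty set, so sections over the empty set
  form the zero ring.\<close>

definition sheaf_of_rings :: "('a, 'r) ringed_space \<Rightarrow> bool" where
  "sheaf_of_rings X \<longleftrightarrow> presheaf_of_rings X \<and>
     (\<forall>\<U>. (\<forall>U \<in> \<U>. open_in X U) \<longrightarrow>
        (\<forall>s \<in> carrier (sections X (\<Union>\<U>)). \<forall>t \<in> carrier (sections X (\<Union>\<U>)).
           (\<forall>U \<in> \<U>. res X (\<Union>\<U>) U s = res X (\<Union>\<U>) U t) \<longrightarrow> s = t) \<and>
        (\<forall>f. (\<forall>U \<in> \<U>. f U \<in> carrier (sections X U)) \<longrightarrow>
           (\<forall>U \<in> \<U>. \<forall>V \<in> \<U>. res X U (U \<inter> V) (f U) = res X V (U \<inter> V) (f V)) \<longrightarrow>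
           (\<exists>s \<in> carrier (sections X (\<Union>\<U>)). \<forall>U \<in> \<U>. res X (\<Union>\<U>) U s = f U)))"

type_synonym ('a, 'r) germ = "('a set \<times> 'r) set"

definition germ :: "('a, 'r) ringed_space \<Rightarrow> 'a \<Rightarrow> 'a set \<Rightarrow> 'r \<Rightarrow> ('a, 'r) germ" where
  "germ X x U s =
     {(V, t). open_in X V \<and> x \<in> V \<and> t \<in> carrier (sections X V) \<and>
        (\<exists>W. open_in X W \<and> x \<in> W \<and> W \<subseteq> U \<inter> V \<and> res X U W s = res X V W t)}"

text \<open>The ring operations on germs are computed on representatives; the unions are over
  families all of whose members coincide.\<close>

definition stalk :: "('a, 'r) ringed_space \<Rightarrow> 'a \<Rightarrow> ('a, 'r) germ ring" where
  "stalk X x =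
     \<lparr>carrier = {germ X x U s | U s. open_in X U \<and> x \<in> U \<and> s \<in> carrier (sections X U)},
      mult = (\<lambda>A B. \<Union>(U, s) \<in> A. \<Union>(V, t) \<in> B.
        germ X x (U \<inter> V) (res X U (U \<inter> V) s \<otimes>\<^bsub>sections X (U \<inter> V)\<^esub> res X V (U \<inter> V) t)),
      one = germ X x (points X) \<one>\<^bsub>sections X (points X)\<^esub>,
      zero = germ X x (points X) \<zero>\<^bsub>sections X (points X)\<^esub>,
      add = (\<lambda>A B. \<Union>(U, s) \<in> A. \<Union>(V, t) \<in> B.
        germ X x (U \<inter> V) (res X U (U \<inter> V) s \<oplus>\<^bsub>sections X (U \<inter> V)\<^esub> res X V (U \<inter> V) t))\<rparr>"

definition locally_ringed_space :: "('a, 'r) ringed_space \<Rightarrow> bool" where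
  "locally_ringed_space X \<longleftrightarrow> sheaf_of_rings X \<and>
     (\<forall>x \<in> points X. cring (stalk X x) \<and> (\<exists>!\<mm>. maximalideal \<mm> (stalk X x)))"

definition max_ideal_at :: "('a, 'r) ringed_space \<Rightarrow> 'a \<Rightarrow> ('a, 'r) germ set" where
  "max_ideal_at X x = (THE \<mm>. maximalideal \<mm> (stalk X x))"

definition residue_field :: "('a, 'r) ringed_space \<Rightarrow> 'a \<Rightarrow> ('a, 'r) germ set ring" where
  "residue_field X x = stalk X x Quot max_ideal_at X x"

definition value_at :: "('a, 'r) ringed_space \<Rightarrow> 'a \<Rightarrow> 'a set \<Rightarrow> 'r \<Rightarrow> ('a, 'r) germ set" where
  "value_at X x U s = max_ideal_at X x +>\<^bsub>stalk X x\<^esub> germ X x U s"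

definition Spec :: "('r, 'm) ring_scheme \<Rightarrow> 'r set set" where
  "Spec R = {P. primeideal P R}"

definition zariski :: "('r, 'm) ring_scheme \<Rightarrow> 'r set topology" where
  "zariski R = topology_generated_by ((\<lambda>h. {P \<in> Spec R. h \<notin> P}) ` carrier R)"

text \<open>\<open>f : R \<rightarrow> S\<close> exhibits \<open>S\<close> as the localization of \<open>R\<close> at the powers of \<open>h\<close>.\<close>

definition is_localization_away ::
    "('r, 'm) ring_scheme \<Rightarrow> 'r \<Rightarrow> ('s, 'n) ring_scheme \<Rightarrow> ('r \<Rightarrow> 's) \<Rightarrow> bool" where
  "is_localization_away R h S f \<longleftrightarrow>
     f \<in> ring_hom R S \<and> f h \<in> Units S \<and>
     (\<forall>t \<in> carrier S. \<exists>a \<in> carrier R. \<exists>n::nat. (f h [^]\<^bsub>S\<^esub> n) \<otimes>\<^bsub>S\<^esub> t = f a) \<and>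
     (\<forall>a \<in> carrier R. f a = \<zero>\<^bsub>S\<^esub> \<longrightarrow> (\<exists>n::nat. (h [^]\<^bsub>R\<^esub> n) \<otimes>\<^bsub>R\<^esub> a = \<zero>\<^bsub>R\<^esub>))"

definition nonvanishing :: "('a, 'r) ringed_space \<Rightarrow> 'a set \<Rightarrow> 'r \<Rightarrow> 'a set" where
  "nonvanishing X U h = {x \<in> U. germ X x U h \<notin> max_ideal_at X x}"

text \<open>\<open>U\<close> is affine: with \<open>R = \<O>(U)\<close>, the canonical map from \<open>U\<close> to \<open>Spec R\<close> is an
  isomorphism onto \<open>Spec R\<close> with its structure sheaf, the latter being the sheaf whose ring of
  sections over the basic open set \<open>D(h)\<close> is the localization of \<open>R\<close> at \<open>h\<close>.\<close>

definition affine_open :: "('a, 'r) ringed_space \<Rightarrow> 'a set \<Rightarrow> bool" where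
  "affine_open X U \<longleftrightarrow> open_in X U \<and>
     homeomorphic_map (subtopology (top_of X) U) (zariski (sections X U))
       (\<lambda>x. {s \<in> carrier (sections X U). germ X x U s \<in> max_ideal_at X x}) \<and>
     (\<forall>h \<in> carrier (sections X U).
        is_localization_away (sections X U) h (sections X (nonvanishing X U h))
          (res X U (nonvanishing X U h)))"

definition scheme :: "('a, 'r) ringed_space \<Rightarrow> bool" where
  "scheme X \<longleftrightarrow> locally_ringed_space X \<and>
     (\<forall>x \<in> points X. \<exists>U. affine_open X U \<and> x \<in> U)"

text \<open>The diagonal is a closed immersion, expressed on the affine open cover of \<open>X \<times> X\<close> by the
  products \<open>U \<times> V\<close>: the preimage \<open>U \<inter> V\<close> is affine and
  \<open>\<O>(U) \<otimes> \<O>(V) \<rightarrow> \<O>(U \<inter> V)\<close> is surjective.\<close>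

definition separated_scheme :: "('a, 'r) ringed_space \<Rightarrow> bool" where
  "separated_scheme X \<longleftrightarrow> scheme X \<and>
     (\<forall>U V. affine_open X U \<longrightarrow> affine_open X V \<longrightarrow>
        affine_open X (U \<inter> V) \<and>
        generate_ring (sections X (U \<inter> V))
          (res X U (U \<inter> V) ` carrier (sections X U) \<union> res X V (U \<inter> V) ` carrier (sections X V))
        = carrier (sections X (U \<inter> V)))"

definition noetherian_scheme :: "('a, 'r) ringed_space \<Rightarrow> bool" where
  "noetherian_scheme X \<longleftrightarrow> scheme X \<and>
     (\<exists>\<U>. finite \<U> \<and> \<Union>\<U> = points X \<and>
        (\<forall>U \<in> \<U>. affine_open X U \<and> noetherian_ring (sections X U)))"

definition integral_scheme :: "('a, 'r) ringed_space \<Rightarrow> bool" where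
  "integral_scheme X \<longleftrightarrow> scheme X \<and> points X \<noteq> {} \<and>
     (\<forall>U. open_in X U \<longrightarrow> U \<noteq> {} \<longrightarrow> domain (sections X U))"

definition has_prime_char :: "('a, 'r) ringed_space \<Rightarrow> nat \<Rightarrow> bool" where
  "has_prime_char X p \<longleftrightarrow> Factorial_Ring.prime p \<and>
     [p] \<cdot>\<^bsub>sections X (points X)\<^esub> \<one>\<^bsub>sections X (points X)\<^esub> = \<zero>\<^bsub>sections X (points X)\<^esub>"

abbreviation (input) closure_pt :: "('a, 'r) ringed_space \<Rightarrow> 'a \<Rightarrow> 'a set" where
  "closure_pt X x \<equiv> top_of X closure_of {x}"

definition generic_point :: "('a, 'r) ringed_space \<Rightarrow> 'a" where
  "generic_point X = (THE x. x \<in> points X \<and> closure_pt X x = points X)"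

definition function_field :: "('a, 'r) ringed_space \<Rightarrow> ('a, 'r) germ ring" where
  "function_field X = stalk X (generic_point X)"

definition to_function_field :: "('a, 'r) ringed_space \<Rightarrow> 'a set \<Rightarrow> 'r \<Rightarrow> ('a, 'r) germ" where
  "to_function_field X U s = germ X (generic_point X) U s"

section \<open>The space of semivaluations\<close>

text \<open>Functions with a prescribed domain are taken to be extensional, so that distinct
  HOL functions are distinct as mathematical objects.\<close>

definition valuation :: "('k, 'm) ring_scheme \<Rightarrow> ('k \<Rightarrow> ereal) \<Rightarrow> bool" where
  "valuation K w \<longleftrightarrow> w \<in> extensional (carrier K) \<and>
     (\<forall>a \<in> carrier K. w a \<noteq> -\<infinity> \<and> (w a = \<infinity> \<longleftrightarrow> a = \<zero>\<^bsub>K\<^esub>)) \<and>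
     (\<forall>a \<in> carrier K. \<forall>b \<in> carrier K.
        w (a \<otimes>\<^bsub>K\<^esub> b) = w a + w b \<and> min (w a) (w b) \<le> w (a \<oplus>\<^bsub>K\<^esub> b))"

text \<open>For \<open>Z\<close> the closure of \<open>x\<close> with reduced structure and \<open>z \<in> Z\<close>: the local ring of \<open>Z\<close> at
  \<open>z\<close> (the image of the local ring of \<open>X\<close> at \<open>z\<close>) inside the residue field at \<open>x\<close>, and its
  maximal ideal.\<close>

definition local_ring_closure :: "('a, 'r) ringed_space \<Rightarrow> 'a \<Rightarrow> 'a \<Rightarrow> ('a, 'r) germ set set" where
  "local_ring_closure X x z =
     {value_at X x U s | U s. open_in X U \<and> z \<in> U \<and> s \<in> carrier (sections X U)}"

definition max_ideal_closure :: "('a, 'r) ringed_space \<Rightarrow> 'a \<Rightarrow> 'a \<Rightarrow> ('a, 'r) germ set set" where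
  "max_ideal_closure X x z =
     {value_at X x U s | U s. open_in X U \<and> z \<in> U \<and> s \<in> carrier (sections X U) \<and>
        germ X z U s \<in> max_ideal_at X z}"

type_synonym ('a, 'r) semival = "(('a, 'r) germ set \<Rightarrow> ereal) \<times> 'a"

definition beth :: "('a, 'r) ringed_space \<Rightarrow> ('a, 'r) semival set" where
  "beth X = {(w, x). x \<in> points X \<and> valuation (residue_field X x) w \<and>
     (\<exists>z \<in> closure_pt X x. \<forall>a \<in> local_ring_closure X x z. 0 \<le> w a)}"

text \<open>The center is the point \<open>z\<close> for which the valuation ring \<open>{a. 0 \<le> w a}\<close>, with maximal
  ideal \<open>{a. 0 < w a}\<close>, dominates the local ring of \<open>Z\<close> at \<open>z\<close>.\<close>

definition center :: "('a, 'r) ringed_space \<Rightarrow> ('a, 'r) semival \<Rightarrow> 'a" where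
  "center X = (\<lambda>(w, x). THE z. z \<in> closure_pt X x \<and>
     (\<forall>a \<in> local_ring_closure X x z. 0 \<le> w a \<and> (0 < w a \<longleftrightarrow> a \<in> max_ideal_closure X x z)))"

definition beth_open :: "('a, 'r) ringed_space \<Rightarrow> 'a set \<Rightarrow> ('a, 'r) semival set" where
  "beth_open X V = {\<zeta> \<in> beth X. center X \<zeta> \<in> V}"

definition semival_apply ::
    "('a, 'r) ringed_space \<Rightarrow> ('a, 'r) semival \<Rightarrow> 'a set \<Rightarrow> 'r \<Rightarrow> ereal" where
  "semival_apply X = (\<lambda>(w, x) V f. w (value_at X x V f))"

text \<open>For affine \<open>V\<close>: the weakest topology making all evaluations continuous.\<close>

definition beth_affine_topology ::
    "('a, 'r) ringed_space \<Rightarrow> 'a set \<Rightarrow> ('a, 'r) semival topology" where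
  "beth_affine_topology X V = topology_generated_by
     {{\<zeta> \<in> beth_open X V. semival_apply X \<zeta> V f \<in> S} | f S.
        f \<in> carrier (sections X V) \<and> open S}"

definition beth_topology :: "('a, 'r) ringed_space \<Rightarrow> ('a, 'r) semival topology" where
  "beth_topology X = topology (\<lambda>\<U>. \<U> \<subseteq> beth X \<and>
     (\<forall>V. affine_open X V \<longrightarrow> openin (beth_affine_topology X V) (\<U> \<inter> beth_open X V)))"

lemma openin_beth_topology:
  "openin (beth_topology X) \<U> \<longleftrightarrow> \<U> \<subseteq> beth X \<and>
     (\<forall>V. affine_open X V \<longrightarrow> openin (beth_affine_topology X V) (\<U> \<inter> beth_open X V))"
proof -
  have "istopology (\<lambda>\<U>. \<U> \<subseteq> beth X \<and>
     (\<forall>V. affine_open X V \<longrightarrow> openin (beth_affine_topology X V) (\<U> \<inter> beth_open X V)))"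
    unfolding istopology_def
  proof (rule conjI; intro allI impI conjI)
    fix S T V
    assume S: "S \<subseteq> beth X \<and>
       (\<forall>V. affine_open X V \<longrightarrow> openin (beth_affine_topology X V) (S \<inter> beth_open X V))"
      and T: "T \<subseteq> beth X \<and>
       (\<forall>V. affine_open X V \<longrightarrow> openin (beth_affine_topology X V) (T \<inter> beth_open X V))"
      and V: "affine_open X V"
    have "S \<inter> T \<inter> beth_open X V = (S \<inter> beth_open X V) \<inter> (T \<inter> beth_open X V)" by blast
    then show "openin (beth_affine_topology X V) (S \<inter> T \<inter> beth_open X V)"
      using S T V by (simp add: openin_Int)
  next
    fix \<K> V
    assume K: "\<forall>K \<in> \<K>. K \<subseteq> beth X \<and>
       (\<forall>V. affine_open X V \<longrightarrow> openin (beth_affine_topology X V) (K \<inter> beth_open X V))"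
      and V: "affine_open X V"
    have "openin (beth_affine_topology X V) (\<Union>((\<lambda>K. K \<inter> beth_open X V) ` \<K>))"
      using K V by (intro openin_Union) blast
    moreover have "\<Union>\<K> \<inter> beth_open X V = \<Union>((\<lambda>K. K \<inter> beth_open X V) ` \<K>)" by blast
    ultimately show "openin (beth_affine_topology X V) (\<Union>\<K> \<inter> beth_open X V)"
      by (simp only:)
  qed blast+
  then show ?thesis
    unfolding beth_topology_def by (simp add: topology_inverse')
qed

section \<open>Cartier algebras\<close>

definition p_inv_linear :: "('k, 'm) ring_scheme \<Rightarrow> nat \<Rightarrow> nat \<Rightarrow> ('k \<Rightarrow> 'k) \<Rightarrow> bool" where
  "p_inv_linear K p e \<psi> \<longleftrightarrow> \<psi> \<in> carrier K \<rightarrow>\<^sub>E carrier K \<and>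
     (\<forall>f \<in> carrier K. \<forall>g \<in> carrier K. \<psi> (f \<oplus>\<^bsub>K\<^esub> g) = \<psi> f \<oplus>\<^bsub>K\<^esub> \<psi> g) \<and>
     (\<forall>f \<in> carrier K. \<forall>g \<in> carrier K. \<psi> ((f [^]\<^bsub>K\<^esub> (p ^ e)) \<otimes>\<^bsub>K\<^esub> g) = f \<otimes>\<^bsub>K\<^esub> \<psi> g)"

definition cartier_maps ::
    "('a, 'r) ringed_space \<Rightarrow> nat \<Rightarrow> nat \<Rightarrow> 'a set \<Rightarrow> (('a, 'r) germ \<Rightarrow> ('a, 'r) germ) set" where
  "cartier_maps X p e U = {\<psi>. p_inv_linear (function_field X) p e \<psi> \<and>
     (\<forall>W. open_in X W \<longrightarrow> W \<noteq> {} \<longrightarrow> W \<subseteq> U \<longrightarrow>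
        \<psi> ` to_function_field X W ` carrier (sections X W)
          \<subseteq> to_function_field X W ` carrier (sections X W))}"

definition scalar_map :: "('k, 'm) ring_scheme \<Rightarrow> 'k \<Rightarrow> ('k \<Rightarrow> 'k) \<Rightarrow> 'k \<Rightarrow> 'k" where
  "scalar_map K a \<psi> = (\<lambda>f \<in> carrier K. a \<otimes>\<^bsub>K\<^esub> \<psi> f)"

text \<open>A graded sheaf on an integral scheme \<open>X\<close> whose sections are maps on the function field is
  given by its homogeneous pieces \<open>D e U\<close>; restriction maps are inclusions. Only nonempty \<open>U\<close>
  matter, as sections over the empty set vanish. Quasi-coherence says that sections over a basic
  open set \<open>D(h)\<close> of an affine \<open>U\<close> are the localization at \<open>h\<close> of the sections over \<open>U\<close>: they
  become sections over \<open>U\<close> after multiplication by a power of \<open>h\<close>. The other requirements on a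
  localization are automatic, as \<open>h\<close> is invertible on \<open>D(h)\<close> and restriction is injective.\<close>

definition cartier_subalgebra ::
    "('a, 'r) ringed_space \<Rightarrow> nat \<Rightarrow> (nat \<Rightarrow> 'a set \<Rightarrow> (('a, 'r) germ \<Rightarrow> ('a, 'r) germ) set) \<Rightarrow> bool"
  where
  "cartier_subalgebra X p D \<longleftrightarrow>
     (let L = function_field X; nonempty_open = (\<lambda>U. open_in X U \<and> U \<noteq> {}) in
       \<comment> \<open>subsheaf\<close>
       (\<forall>e U. nonempty_open U \<longrightarrow> D e U \<subseteq> cartier_maps X p e U) \<and>
       (\<forall>e U V. nonempty_open U \<longrightarrow> nonempty_open V \<longrightarrow> V \<subseteq> U \<longrightarrow> D e U \<subseteq> D e V) \<and>
       (\<forall>e \<U>. \<U> \<noteq> {} \<longrightarrow> (\<forall>U \<in> \<U>. nonempty_open U) \<longrightarrow> (\<Inter>U \<in> \<U>. D e U) \<subseteq> D e (\<Union>\<U>)) \<and>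
       \<comment> \<open>graded subring\<close>
       (\<forall>e U. nonempty_open U \<longrightarrow>
          (\<lambda>f \<in> carrier L. \<zero>\<^bsub>L\<^esub>) \<in> D e U \<and>
          (\<forall>\<psi> \<in> D e U. (\<lambda>f \<in> carrier L. \<ominus>\<^bsub>L\<^esub> \<psi> f) \<in> D e U) \<and>
          (\<forall>\<psi> \<in> D e U. \<forall>\<phi> \<in> D e U. (\<lambda>f \<in> carrier L. \<psi> f \<oplus>\<^bsub>L\<^esub> \<phi> f) \<in> D e U)) \<and>
       (\<forall>d e U. nonempty_open U \<longrightarrow>
          (\<forall>\<psi> \<in> D d U. \<forall>\<phi> \<in> D e U. compose (carrier L) \<psi> \<phi> \<in> D (d + e) U)) \<and>
       \<comment> \<open>the degree zero part is the structure sheaf, acting by multiplication\<close>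
       (\<forall>U. nonempty_open U \<longrightarrow>
          D 0 U = (\<lambda>s. scalar_map L (to_function_field X U s) (\<lambda>f. f)) ` carrier (sections X U)) \<and>
       \<comment> \<open>quasi-coherence\<close>
       (\<forall>e U h. affine_open X U \<longrightarrow> h \<in> carrier (sections X U) \<longrightarrow> nonvanishing X U h \<noteq> {} \<longrightarrow>
          (\<forall>\<psi> \<in> D e (nonvanishing X U h). \<exists>n::nat.
             scalar_map L (to_function_field X U h [^]\<^bsub>L\<^esub> n) \<psi> \<in> D e U)))"

definition cartier_stalk ::
    "('a, 'r) ringed_space \<Rightarrow> (nat \<Rightarrow> 'a set \<Rightarrow> (('a, 'r) germ \<Rightarrow> ('a, 'r) germ) set) \<Rightarrow>
     nat \<Rightarrow> 'a \<Rightarrow> (('a, 'r) germ \<Rightarrow> ('a, 'r) germ) set" where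
  "cartier_stalk X D e x = \<Union>{D e U | U. open_in X U \<and> x \<in> U}"

text \<open>The stalk at \<open>x\<close>, inside the function field, of the ideal sheaf of functions vanishing at
  all points of \<open>Z\<close>.\<close>

definition ideal_stalk :: "('a, 'r) ringed_space \<Rightarrow> 'a set \<Rightarrow> 'a \<Rightarrow> ('a, 'r) germ set" where
  "ideal_stalk X Z x =
     {to_function_field X U s | U s. open_in X U \<and> x \<in> U \<and> s \<in> carrier (sections X U) \<and>
        (\<forall>z \<in> Z \<inter> U. germ X z U s \<in> max_ideal_at X z)}"

definition uniformly_compatible ::
    "('a, 'r) ringed_space \<Rightarrow> (nat \<Rightarrow> 'a set \<Rightarrow> (('a, 'r) germ \<Rightarrow> ('a, 'r) germ) set) \<Rightarrow>
     'a set \<Rightarrow> bool" where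
  "uniformly_compatible X D Z \<longleftrightarrow>
     (\<forall>x \<in> points X. \<forall>e \<ge> 1. \<forall>\<psi> \<in> cartier_stalk X D e x. \<psi> ` ideal_stalk X Z x \<subseteq> ideal_stalk X Z x)"

text \<open>For \<open>Z\<close> the closure of \<open>y\<close>, whose function field is the residue field at \<open>y\<close>: \<open>\<phi>\<close> is the
  map on that field induced by \<open>\<psi>\<close>, a germ at \<open>z \<in> Z\<close>. That is, \<open>\<phi>\<close> is \<open>p\<^sup>-\<^sup>e\<close>-linear and
  \<open>\<phi> (f(y)) = \<psi>(f)(y)\<close> for all \<open>f\<close> in the local ring of \<open>X\<close> at \<open>z\<close>.\<close>

definition induces ::
    "('a, 'r) ringed_space \<Rightarrow> nat \<Rightarrow> nat \<Rightarrow> 'a \<Rightarrow> 'a \<Rightarrow> (('a, 'r) germ \<Rightarrow> ('a, 'r) germ) \<Rightarrow>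
     (('a, 'r) germ set \<Rightarrow> ('a, 'r) germ set) \<Rightarrow> bool" where
  "induces X p e y z \<psi> \<phi> \<longleftrightarrow> p_inv_linear (residue_field X y) p e \<phi> \<and>
     (\<forall>U s V t. open_in X U \<longrightarrow> z \<in> U \<longrightarrow> s \<in> carrier (sections X U) \<longrightarrow>
        open_in X V \<longrightarrow> z \<in> V \<longrightarrow> t \<in> carrier (sections X V) \<longrightarrow>
        \<psi> (to_function_field X U s) = to_function_field X V t \<longrightarrow>
        \<phi> (value_at X y U s) = value_at X y V t)"

text \<open>The sheaf on \<open>Z\<close> of maps locally induced by sections of \<open>D\<close>, and its stalks.\<close>

definition cartier_restrict ::
    "('a, 'r) ringed_space \<Rightarrow> nat \<Rightarrow> (nat \<Rightarrow> 'a set \<Rightarrow> (('a, 'r) germ \<Rightarrow> ('a, 'r) germ) set) \<Rightarrow>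
     'a \<Rightarrow> nat \<Rightarrow> 'a set \<Rightarrow> (('a, 'r) germ set \<Rightarrow> ('a, 'r) germ set) set" where
  "cartier_restrict X p D y e W = {\<phi>. p_inv_linear (residue_field X y) p e \<phi> \<and>
     (\<forall>z \<in> W. \<exists>\<psi> \<in> cartier_stalk X D e z. induces X p e y z \<psi> \<phi>)}"

definition cartier_restrict_stalk ::
    "('a, 'r) ringed_space \<Rightarrow> nat \<Rightarrow> (nat \<Rightarrow> 'a set \<Rightarrow> (('a, 'r) germ \<Rightarrow> ('a, 'r) germ) set) \<Rightarrow>
     'a \<Rightarrow> nat \<Rightarrow> 'a \<Rightarrow> (('a, 'r) germ set \<Rightarrow> ('a, 'r) germ set) set" where
  "cartier_restrict_stalk X p D y e z =
     \<Union>{cartier_restrict X p D y e W | W.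
         openin (subtopology (top_of X) (closure_pt X y)) W \<and> z \<in> W}"

section \<open>Log discrepancies\<close>

definition E_quot ::
    "nat \<Rightarrow> nat \<Rightarrow> ('k \<Rightarrow> ereal) \<Rightarrow> 'k \<Rightarrow> ('k \<Rightarrow> 'k) \<Rightarrow> ereal" where
  "E_quot p e v f \<psi> = (v f - ereal (real p ^ e) * v (\<psi> f)) / ereal (real p ^ e - 1)"

text \<open>Here \<open>\<psi>\<close> is \<open>p\<^sup>-\<^sup>e\<close>-linear, so its \<open>n\<close>-th iterate is \<open>p\<^sup>-\<^sup>n\<^sup>e\<close>-linear.\<close>

definition log_discrepancy_map ::
    "('k, 'm) ring_scheme \<Rightarrow> nat \<Rightarrow> nat \<Rightarrow> ('k \<Rightarrow> ereal) \<Rightarrow> ('k \<Rightarrow> 'k) \<Rightarrow> ereal" where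
  "log_discrepancy_map K p e v \<psi> =
     Sup {E_quot p (n * e) v f (\<psi> ^^ n) | f n. f \<in> carrier K - {\<zero>\<^bsub>K\<^esub>} \<and> n \<ge> 1}"

text \<open>The log discrepancy of a valuation on the function field \<open>K\<close> of an integral scheme with
  respect to a Cartier algebra \<open>D\<close>, where \<open>S e\<close> is the stalk of the degree \<open>e\<close> part of \<open>D\<close> at
  the center of the valuation.\<close>

definition log_discrepancy_stalk ::
    "('k, 'm) ring_scheme \<Rightarrow> nat \<Rightarrow> ('k \<Rightarrow> ereal) \<Rightarrow> (nat \<Rightarrow> ('k \<Rightarrow> 'k) set) \<Rightarrow> ereal" where
  "log_discrepancy_stalk K p v S =
     Sup {log_discrepancy_map K p e v \<psi> | e \<psi>.
        e \<ge> 1 \<and> \<psi> \<in> S e \<and> (\<exists>f \<in> carrier K. \<psi> f \<noteq> \<zero>\<^bsub>K\<^esub>)}"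

definition log_discrepancy ::
    "('a, 'r) ringed_space \<Rightarrow> nat \<Rightarrow> (nat \<Rightarrow> 'a set \<Rightarrow> (('a, 'r) germ \<Rightarrow> ('a, 'r) germ) set) \<Rightarrow>
     ('a, 'r) semival \<Rightarrow> ereal" where
  "log_discrepancy X p D = (\<lambda>(w, y).
     if uniformly_compatible X D (closure_pt X y)
     then log_discrepancy_stalk (residue_field X y) p w
            (\<lambda>e. cartier_restrict_stalk X p D y e (center X (w, y)))
     else \<infinity>)"

end

theory Submission
  imports Defs
begin

text \<open>Let \<open>V\<close> be an affine open subset. On the semivaluations centered in \<open>V\<close>, the set where
  \<open>A > a\<close> is the union, over all \<open>e \<ge> 1\<close>, all \<open>\<Psi> \<in> D\<^sub>e(V)\<close> and all \<open>f, g \<in> \<O>(V)\<close> with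
  \<open>\<Psi>(f) = g\<close>, of the sets
  where \<open>\<zeta>(g) < \<infinity>\<close> and \<open>\<zeta>(f) > p\<^sup>e \<zeta>(g) + a (p\<^sup>e - 1)\<close>, each of which is visibly open.
  If the closure \<open>Z\<close> of the home of \<open>\<zeta>\<close> is uniformly compatible, then \<open>\<Psi>\<close> induces a map on the
  residue field, and the second inequality says that \<open>E(f, \<Psi>, \<zeta>) > a\<close>. Conversely an arbitrary element of
  the residue field becomes a value of some \<open>f \<in> \<O>(V)\<close> after multiplication by a \<open>p\<^sup>e\<close>-th
  power, which does not affect \<open>E\<close>, and by quasi-coherence a germ of \<open>D\<^sub>e\<close> at the center extends to \<open>V\<close> after
  multiplication by a function that is a unit at the center and hence has valuation \<open>0\<close>.
  If \<open>Z\<close> is not compatible, the same denominators can be cleared from a pair with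
  \<open>\<zeta>(f) = \<infinity>\<close> and \<open>\<zeta>(g) < \<infinity>\<close>: the inequality then detects \<open>A = \<infinity>\<close>.\<close>

section \<open>Germs and values\<close>

lemma ring_hom_nat_pow:
  assumes "ring R" "ring S" "h \<in> ring_hom R S" "x \<in> carrier R"
  shows "h (x [^]\<^bsub>R\<^esub> (n::nat)) = h x [^]\<^bsub>S\<^esub> n"
proof -
  interpret ring_hom_ring R S h
    using assms by (intro ring_hom_ringI2)
  show ?thesis using assms(4) by (rule hom_nat_pow)
qed

locale local_ringed =
  fixes X :: "('a, 'r) ringed_space"
  assumes lrs: "locally_ringed_space X"
begin

abbreviation opn :: "'a set \<Rightarrow> bool" where "opn U \<equiv> openin (top_of X) U"
abbreviation Sec :: "'a set \<Rightarrow> 'r set" where "Sec U \<equiv> carrier (sections X U)"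

lemma presheaf: "presheaf_of_rings X"
  using lrs by (auto simp: locally_ringed_space_def sheaf_of_rings_def)

lemma sections_cring: "opn U \<Longrightarrow> cring (sections X U)"
  using presheaf by (auto simp: presheaf_of_rings_def)

lemma sections_ring: "opn U \<Longrightarrow> ring (sections X U)"
  using sections_cring cring.axioms(1) by blast

lemma res_hom: "opn U \<Longrightarrow> opn V \<Longrightarrow> V \<subseteq> U \<Longrightarrow> res X U V \<in> ring_hom (sections X U) (sections X V)"
  using presheaf by (auto simp: presheaf_of_rings_def)

lemma res_closed: "opn U \<Longrightarrow> opn V \<Longrightarrow> V \<subseteq> U \<Longrightarrow> s \<in> Sec U \<Longrightarrow> res X U V s \<in> Sec V"
  by (rule ring_hom_closed[OF res_hom])

lemma res_id: "opn U \<Longrightarrow> s \<in> Sec U \<Longrightarrow> res X U U s = s"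
  using presheaf by (auto simp: presheaf_of_rings_def)

lemma res_res:
  "opn U \<Longrightarrow> opn V \<Longrightarrow> opn W \<Longrightarrow> W \<subseteq> V \<Longrightarrow> V \<subseteq> U \<Longrightarrow> s \<in> Sec U \<Longrightarrow>
    res X V W (res X U V s) = res X U W s"
  using presheaf unfolding presheaf_of_rings_def by blast

lemma pow_closed: "opn U \<Longrightarrow> s \<in> Sec U \<Longrightarrow> s [^]\<^bsub>sections X U\<^esub> (n::nat) \<in> Sec U"
  by (simp add: monoid.nat_pow_closed ring.is_monoid sections_ring)

lemma mult_closed: "opn U \<Longrightarrow> s \<in> Sec U \<Longrightarrow> t \<in> Sec U \<Longrightarrow> s \<otimes>\<^bsub>sections X U\<^esub> t \<in> Sec U"
  by (simp add: monoid.m_closed ring.is_monoid sections_ring)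

lemma add_closed: "opn U \<Longrightarrow> s \<in> Sec U \<Longrightarrow> t \<in> Sec U \<Longrightarrow> s \<oplus>\<^bsub>sections X U\<^esub> t \<in> Sec U"
  by (simp add: sections_ring ring.ring_simprules(1))

lemma one_closed: "opn U \<Longrightarrow> \<one>\<^bsub>sections X U\<^esub> \<in> Sec U"
  by (simp add: ring.ring_simprules(6) sections_ring)

lemma zero_closed: "opn U \<Longrightarrow> \<zero>\<^bsub>sections X U\<^esub> \<in> Sec U"
  by (simp add: ring.ring_simprules(2) sections_ring)

lemma res_restrict_eq:
  assumes "opn U" "opn V" "opn W" "opn W'" "W' \<subseteq> W" "W \<subseteq> U" "W \<subseteq> V" "s \<in> Sec U" "t \<in> Sec V"
    and "res X U W s = res X V W t"
  shows "res X U W' s = res X V W' t"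
  using assms res_res[of U W W' s] res_res[of V W W' t] by simp

lemma germ_memI:
  "opn U \<Longrightarrow> x \<in> U \<Longrightarrow> s \<in> Sec U \<Longrightarrow> (U, s) \<in> germ X x U s"
  by (auto simp: germ_def intro!: exI[of _ U])

lemma germ_eqI:
  assumes U: "opn U" "x \<in> U" "s \<in> Sec U" and V: "opn V" "x \<in> V" "t \<in> Sec V"
    and W: "opn W" "x \<in> W" "W \<subseteq> U" "W \<subseteq> V" and eq: "res X U W s = res X V W t"
  shows "germ X x U s = germ X x V t"
proof -
  \<comment> \<open>The claim is symmetric, so one inclusion is proved for arbitrary representatives
    agreeing on the fixed neighbourhood \<open>W\<close> and is then used in both
    directions.\<close>
  have "germ X x U s \<subseteq> germ X x V t"
    if U: "opn U" "x \<in> U" "s \<in> Sec U" and V: "opn V" "x \<in> V" "t \<in> Sec V"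
      and W: "W \<subseteq> U" "W \<subseteq> V" and eq: "res X U W s = res X V W t" for U V s t
  proof clarify
    fix U' s' assume "(U', s') \<in> germ X x U s"
    then obtain W' where U': "opn U'" "x \<in> U'" "s' \<in> Sec U'"
      and W': "opn W'" "x \<in> W'" "W' \<subseteq> U" "W' \<subseteq> U'" "res X U W' s = res X U' W' s'"
      by (auto simp: germ_def)
    let ?W = "W \<inter> W'"
    have o: "opn ?W" "x \<in> ?W" using \<open>opn W\<close> \<open>x \<in> W\<close> W' by auto
    have "res X V ?W t = res X U ?W s"
      using res_restrict_eq[of U V W ?W s t] U V W \<open>opn W\<close> eq o by simp
    also have "\<dots> = res X U' ?W s'"
      using res_restrict_eq[of U U' W' ?W s s'] U U' W' o by simp
    finally show "(U', s') \<in> germ X x V t"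
      using U' o W W' by (auto simp: germ_def intro!: exI[of _ ?W])
  qed
  from this[OF U V W(3,4) eq] this[OF V U W(4,3) eq[symmetric]] show ?thesis by blast
qed

lemma germ_eqD:
  assumes "germ X x U s = germ X x V t" "opn V" "x \<in> V" "t \<in> Sec V"
  obtains W where "opn W" "x \<in> W" "W \<subseteq> U" "W \<subseteq> V" "res X U W s = res X V W t"
proof -
  have "(V, t) \<in> germ X x U s" using germ_memI assms by simp
  then show ?thesis using that by (auto simp: germ_def)
qed

lemma germ_res:
  assumes "opn U" "opn V" "V \<subseteq> U" "x \<in> V" "s \<in> Sec U"
  shows "germ X x V (res X U V s) = germ X x U s"
  using assms res_closed[of U V s] res_id[of V] by (intro germ_eqI[where W = V]) auto

lemma germ_mem_eq:
  assumes "(V, t) \<in> germ X x U s" "opn U" "x \<in> U" "s \<in> Sec U"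
  shows "opn V" "x \<in> V" "t \<in> Sec V" "germ X x V t = germ X x U s"
proof -
  from assms obtain W where V: "opn V" "x \<in> V" "t \<in> Sec V" "opn W" "x \<in> W" "W \<subseteq> U" "W \<subseteq> V"
     "res X U W s = res X V W t"
    by (auto simp: germ_def)
  then show "opn V" "x \<in> V" "t \<in> Sec V" by auto
  show "germ X x V t = germ X x U s"
    using V assms by (intro germ_eqI[where W = W]) auto
qed

section \<open>Ring structure on stalks\<close>

lemma germ_Int_eq:
  assumes "opn U" "x \<in> U" "s \<in> Sec U" "(V, t) \<in> germ X x U s"
    and "opn U'" "x \<in> U'" "s' \<in> Sec U'" "(V', t') \<in> germ X x U' s'"
  obtains W where "opn W" "x \<in> W" "W \<subseteq> U \<inter> U'" "W \<subseteq> V \<inter> V'"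
    "res X U W s = res X V W t" "res X U' W s' = res X V' W t'"
proof -
  from assms(4) obtain W where W: "opn V" "t \<in> Sec V" "opn W" "x \<in> W" "W \<subseteq> U" "W \<subseteq> V"
     "res X U W s = res X V W t" by (auto simp: germ_def)
  from assms(8) obtain W' where W': "opn V'" "t' \<in> Sec V'" "opn W'" "x \<in> W'" "W' \<subseteq> U'" "W' \<subseteq> V'"
     "res X U' W' s' = res X V' W' t'" by (auto simp: germ_def)
  have o: "opn (W \<inter> W')" using W W' by auto
  show ?thesis
    using W W' o assms res_restrict_eq[of U V W "W \<inter> W'" s t]
      res_restrict_eq[of U' V' W' "W \<inter> W'" s' t']
    by (intro that[of "W \<inter> W'"]) auto
qed

text \<open>The operations in \<open>stalk\<close> are unions over all pairs of representatives. All
  members of the union coincide: two pairs agree on a common neighbourhood \<open>W\<close>, and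
  \<open>f\<close> commutes with restriction to \<open>W\<close>. The operation is a parameter so
  that sums and products are treated together.\<close>

lemma stalk_binop:
  assumes f: "\<And>U V s t. opn U \<Longrightarrow> opn V \<Longrightarrow> V \<subseteq> U \<Longrightarrow> s \<in> Sec U \<Longrightarrow> t \<in> Sec U \<Longrightarrow>
      f U s t \<in> Sec U \<and> res X U V (f U s t) = f V (res X U V s) (res X U V t)"
    and s: "opn U" "x \<in> U" "s \<in> Sec U" and t: "opn V" "x \<in> V" "t \<in> Sec V"
  shows "(\<Union>(U, s) \<in> germ X x U s. \<Union>(V, t) \<in> germ X x V t.
        germ X x (U \<inter> V) (f (U \<inter> V) (res X U (U \<inter> V) s) (res X V (U \<inter> V) t))) =
     germ X x (U \<inter> V) (f (U \<inter> V) (res X U (U \<inter> V) s) (res X V (U \<inter> V) t))"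
proof -
  have *: "germ X x (U' \<inter> V') (f (U' \<inter> V') (res X U' (U' \<inter> V') s') (res X V' (U' \<inter> V') t')) =
      germ X x (U \<inter> V) (f (U \<inter> V) (res X U (U \<inter> V) s) (res X V (U \<inter> V) t))"
    if m: "(U', s') \<in> germ X x U s" "(V', t') \<in> germ X x V t" for U' s' V' t'
  proof -
    note a = germ_mem_eq[OF m(1) s] germ_mem_eq[OF m(2) t]
    obtain W where W: "opn W" "x \<in> W" "W \<subseteq> U \<inter> V" "W \<subseteq> U' \<inter> V'"
       "res X U W s = res X U' W s'" "res X V W t = res X V' W t'"
      using germ_Int_eq[OF s m(1) t m(2)] by blast
    have o: "opn (U \<inter> V)" "opn (U' \<inter> V')" using s t a by auto
    let ?s = "res X U (U \<inter> V) s" and ?t = "res X V (U \<inter> V) t"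
    let ?s' = "res X U' (U' \<inter> V') s'" and ?t' = "res X V' (U' \<inter> V') t'"
    have c: "?s \<in> Sec (U \<inter> V)" "?t \<in> Sec (U \<inter> V)" "?s' \<in> Sec (U' \<inter> V')" "?t' \<in> Sec (U' \<inter> V')"
      using s t a o by (auto intro: res_closed)
    have r: "res X (U \<inter> V) W ?s = res X U W s" "res X (U \<inter> V) W ?t = res X V W t"
      "res X (U' \<inter> V') W ?s' = res X U' W s'" "res X (U' \<inter> V') W ?t' = res X V' W t'"
      using s(1,3) t(1,3) a(1,3,5,7) o W(1,3,4) by (simp_all add: res_res)
    have "res X (U' \<inter> V') W (f (U' \<inter> V') ?s' ?t') = f W (res X U' W s') (res X V' W t')"
      using f[OF o(2) W(1,4) c(3,4)] r by simp
    also have "\<dots> = f W (res X U W s) (res X V W t)"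
      by (simp only: W(5,6))
    also have "\<dots> = res X (U \<inter> V) W (f (U \<inter> V) ?s ?t)"
      using f[OF o(1) W(1,3) c(1,2)] r by simp
    finally show ?thesis
      using f[OF o(1) W(1,3) c(1,2)] f[OF o(2) W(1,4) c(3,4)] o W(1-4) s(2) t(2) a(2,6)
      by (intro germ_eqI[where W = W]) simp_all
  qed
  \<comment> \<open>A union of equal sets collapses only over a nonempty index set; the given
    representatives supply an index through \<open>germ_memI\<close>.\<close>
  have UN_const: "(\<Union>q \<in> A. F q) = c" if "\<And>q. q \<in> A \<Longrightarrow> F q = c" "a \<in> A"
    for A :: "('a, 'r) germ" and F and c :: "('a, 'r) germ" and a
    using that by blast
  show ?thesis
    by (rule UN_const[OF _ germ_memI[OF s]], clarify, rule UN_const[OF _ germ_memI[OF t]], clarify)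
      (rule *)
qed

lemma germ_hom:
  assumes U: "opn U" "x \<in> U"
  shows "germ X x U \<in> ring_hom (sections X U) (stalk X x)"
proof (rule ring_hom_memI)
  show "germ X x U s \<in> carrier (stalk X x)" if "s \<in> Sec U" for s
    using U that by (auto simp: stalk_def)
  show "germ X x U (s \<otimes>\<^bsub>sections X U\<^esub> t) = germ X x U s \<otimes>\<^bsub>stalk X x\<^esub> germ X x U t"
    if st: "s \<in> Sec U" "t \<in> Sec U" for s t
    using stalk_binop[where f = "\<lambda>U s t. s \<otimes>\<^bsub>sections X U\<^esub> t" and x = x, OF _ U st(1) U st(2)]
    by (simp add: stalk_def mult_closed ring_hom_mult[OF res_hom] res_id U st)
  show "germ X x U (s \<oplus>\<^bsub>sections X U\<^esub> t) = germ X x U s \<oplus>\<^bsub>stalk X x\<^esub> germ X x U t"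
    if st: "s \<in> Sec U" "t \<in> Sec U" for s t
    using stalk_binop[where f = "\<lambda>U s t. s \<oplus>\<^bsub>sections X U\<^esub> t" and x = x, OF _ U st(1) U st(2)]
    by (simp add: stalk_def add_closed ring_hom_add[OF res_hom] res_id U st)
  have "U \<subseteq> points X" using U by (simp add: openin_subset)
  then show "germ X x U \<one>\<^bsub>sections X U\<^esub> = \<one>\<^bsub>stalk X x\<^esub>"
    using germ_res[of "points X" U x "\<one>\<^bsub>sections X (points X)\<^esub>"] U
    by (simp add: stalk_def one_closed ring_hom_one[OF res_hom])
qed

section \<open>Residue fields and values of sections\<close>

lemma stalk_cring: "x \<in> points X \<Longrightarrow> cring (stalk X x)"
  using lrs by (auto simp: locally_ringed_space_def)

lemma maximalideal_max_ideal_at: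
  assumes "x \<in> points X"
  shows "maximalideal (max_ideal_at X x) (stalk X x)"
proof -
  have "\<forall>x \<in> points X. cring (stalk X x) \<and> (\<exists>!\<mm>. maximalideal \<mm> (stalk X x))"
    using lrs unfolding locally_ringed_space_def by (rule conjunct2)
  from theI'[OF conjunct2[OF bspec[OF this assms]]] show ?thesis
    unfolding max_ideal_at_def .
qed

lemma opn_points: "opn U \<Longrightarrow> x \<in> U \<Longrightarrow> x \<in> points X"
  using openin_subset by blast

lemma residue_field_field: "x \<in> points X \<Longrightarrow> field (residue_field X x)"
  unfolding residue_field_def
  by (rule maximalideal.quotient_is_field[OF maximalideal_max_ideal_at stalk_cring])

lemma residue_field_cring: "x \<in> points X \<Longrightarrow> cring (residue_field X x)"
  by (rule fieldE(1)[OF residue_field_field])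

lemma residue_field_ring: "x \<in> points X \<Longrightarrow> ring (residue_field X x)"
  by (rule cring.axioms(1)[OF residue_field_cring])

lemma stalk_ring: "x \<in> points X \<Longrightarrow> ring (stalk X x)"
  by (rule cring.axioms(1)[OF stalk_cring])

lemma coset_hom:
  "x \<in> points X \<Longrightarrow> (+>\<^bsub>stalk X x\<^esub>) (max_ideal_at X x) \<in> ring_hom (stalk X x) (residue_field X x)"
  unfolding residue_field_def
  by (rule ideal.rcos_ring_hom[OF maximalideal.axioms(1)[OF maximalideal_max_ideal_at]])

lemma value_hom:
  assumes "opn U" "x \<in> U"
  shows "value_at X x U \<in> ring_hom (sections X U) (residue_field X x)"
proof -
  have "value_at X x U = (+>\<^bsub>stalk X x\<^esub>) (max_ideal_at X x) \<circ> germ X x U"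
    by (auto simp: value_at_def)
  then show ?thesis
    using ring_hom_trans[OF germ_hom[OF assms] coset_hom[OF opn_points[OF assms]]] by simp
qed

lemma value_closed: "opn U \<Longrightarrow> x \<in> U \<Longrightarrow> s \<in> Sec U \<Longrightarrow> value_at X x U s \<in> carrier (residue_field X x)"
  by (rule ring_hom_closed[OF value_hom])

lemma value_zero_iff:
  assumes "opn U" "x \<in> U" "s \<in> Sec U"
  shows "value_at X x U s = \<zero>\<^bsub>residue_field X x\<^esub> \<longleftrightarrow> germ X x U s \<in> max_ideal_at X x"
proof -
  interpret maximalideal "max_ideal_at X x" "stalk X x"
    using maximalideal_max_ideal_at opn_points assms by blast
  have "germ X x U s \<in> carrier (stalk X x)" using ring_hom_closed[OF germ_hom] assms by blast
  then show ?thesis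
    using rcos_const_imp_mem a_rcos_const
    by (auto simp: value_at_def residue_field_def FactRing_def)
qed

lemma value_res:
  assumes "opn U" "opn V" "V \<subseteq> U" "x \<in> V" "s \<in> Sec U"
  shows "value_at X x V (res X U V s) = value_at X x U s"
  using assms by (simp add: value_at_def germ_res)

lemma value_surj:
  assumes "\<alpha> \<in> carrier (residue_field X x)"
  obtains U s where "opn U" "x \<in> U" "s \<in> Sec U" "\<alpha> = value_at X x U s"
  using assms
  by (auto simp: residue_field_def FactRing_def A_RCOSETS_def' stalk_def value_at_def)

lemma value_pow:
  "opn U \<Longrightarrow> x \<in> U \<Longrightarrow> s \<in> Sec U \<Longrightarrow>
    value_at X x U (s [^]\<^bsub>sections X U\<^esub> (n::nat)) = value_at X x U s [^]\<^bsub>residue_field X x\<^esub> n"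
  by (intro ring_hom_nat_pow value_hom sections_ring residue_field_ring opn_points)

lemma germ_pow:
  "opn U \<Longrightarrow> x \<in> U \<Longrightarrow> s \<in> Sec U \<Longrightarrow>
    germ X x U (s [^]\<^bsub>sections X U\<^esub> (n::nat)) = germ X x U s [^]\<^bsub>stalk X x\<^esub> n"
  by (intro ring_hom_nat_pow germ_hom sections_ring stalk_ring opn_points)

lemma value_zero: "opn U \<Longrightarrow> x \<in> U \<Longrightarrow> value_at X x U \<zero>\<^bsub>sections X U\<^esub> = \<zero>\<^bsub>residue_field X x\<^esub>"
  by (rule ring_hom_zero[OF value_hom]) (auto intro: sections_ring residue_field_ring opn_points)

lemma germ_zero: "opn U \<Longrightarrow> x \<in> U \<Longrightarrow> germ X x U \<zero>\<^bsub>sections X U\<^esub> = \<zero>\<^bsub>stalk X x\<^esub>"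
  by (rule ring_hom_zero[OF germ_hom]) (auto intro: sections_ring stalk_ring opn_points)

lemma nonvanishing_iff:
  assumes "opn U" "s \<in> Sec U"
  shows "x \<in> nonvanishing X U s \<longleftrightarrow> x \<in> U \<and> value_at X x U s \<noteq> \<zero>\<^bsub>residue_field X x\<^esub>"
  using assms value_zero_iff by (auto simp: nonvanishing_def)

lemma nonvanishing_subset: "nonvanishing X U s \<subseteq> U"
  by (auto simp: nonvanishing_def)

end

lemma (in domain) nat_pow_nonzero: "a \<in> carrier R \<Longrightarrow> a \<noteq> \<zero> \<Longrightarrow> a [^] (n::nat) \<noteq> \<zero>"
  by (induction n) (auto simp: integral_iff)

lemma (in domain) pow_mult_zero_iff:
  "h \<in> carrier R \<Longrightarrow> s \<in> carrier R \<Longrightarrow> h \<noteq> \<zero> \<Longrightarrow> h [^] (n::nat) \<otimes> s = \<zero> \<longleftrightarrow> s = \<zero>"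
  using nat_pow_nonzero integral_iff by simp

section \<open>Affine charts\<close>

text \<open>The induction follows the generation of \<open>W\<close> from the subbase of sets D(h).
  These form a base because D(h1) \<inter> D(h2) = D(h1 h2): one inclusion is primality, the other
  the ideal property.\<close>

lemma zariski_basis:
  assumes R: "cring R" and W: "openin (zariski R) W" and P: "P \<in> W"
  shows "P \<in> Spec R \<and> (\<exists>h \<in> carrier R. h \<notin> P \<and> {Q \<in> Spec R. h \<notin> Q} \<subseteq> W)"
proof -
  interpret cring R by fact
  have "generate_topology_on ((\<lambda>h. {P \<in> Spec R. h \<notin> P}) ` carrier R) W"
    using W by (simp add: zariski_def openin_topology_generated_by_iff)
  then show ?thesis
    using P
  proof (induction)
    case (Int W1 W2)
    then obtain h1 h2 where P: "P \<in> Spec R" and h: "h1 \<in> carrier R" "h1 \<notin> P" "{Q \<in> Spec R. h1 \<notin> Q} \<subseteq> W1"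
        "h2 \<in> carrier R" "h2 \<notin> P" "{Q \<in> Spec R. h2 \<notin> Q} \<subseteq> W2"
      by auto
    have "h1 \<otimes>\<^bsub>R\<^esub> h2 \<notin> P"
      using P h primeideal.I_prime[of P R h1 h2] by (auto simp: Spec_def)
    moreover have "h1 \<notin> Q \<and> h2 \<notin> Q" if "Q \<in> Spec R" "h1 \<otimes>\<^bsub>R\<^esub> h2 \<notin> Q" for Q
    proof -
      interpret primeideal Q R using that by (simp add: Spec_def)
      show ?thesis using that h I_l_closed I_r_closed by blast
    qed
    ultimately show ?case
      using P h by (intro conjI bexI[of _ "h1 \<otimes>\<^bsub>R\<^esub> h2"]) blast+
  next
    case (UN \<W>)
    then obtain W where "W \<in> \<W>" "P \<in> W" by blast
    then show ?case using UN.IH by blast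
  qed auto
qed

lemma openin_zariski: "h \<in> carrier R \<Longrightarrow> openin (zariski R) {P \<in> Spec R. h \<notin> P}"
  unfolding zariski_def by (rule topology_generated_by_Basis) auto

lemma topspace_zariski:
  assumes "cring R"
  shows "topspace (zariski R) = Spec R"
proof
  show "topspace (zariski R) \<subseteq> Spec R"
    using zariski_basis[OF assms openin_topspace] by blast
next
  interpret cring R by fact
  have "\<one>\<^bsub>R\<^esub> \<notin> P" if "P \<in> Spec R" for P
    using that ideal.one_imp_carrier[of P R] primeideal.I_notcarr[of P R] primeideal.axioms(1)[of P R]
    by (auto simp: Spec_def)
  then have "Spec R = {P \<in> Spec R. \<one>\<^bsub>R\<^esub> \<notin> P}" by blast
  then show "Spec R \<subseteq> topspace (zariski R)"
    using openin_subset[OF openin_zariski[of "\<one>\<^bsub>R\<^esub>" R]] by simp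
qed

section \<open>Points of an affine open set as prime ideals\<close>

context local_ringed begin

text \<open>The chart map of \<open>affine_open\<close>, sending a point to the corresponding prime
  ideal of the ring of sections.\<close>

definition vanishing_ideal :: "'a set \<Rightarrow> 'a \<Rightarrow> 'r set" where
  "vanishing_ideal V x = {s \<in> Sec V. germ X x V s \<in> max_ideal_at X x}"

lemma vanishing_ideal_iff:
  "opn V \<Longrightarrow> x \<in> V \<Longrightarrow> s \<in> Sec V \<Longrightarrow> s \<in> vanishing_ideal V x \<longleftrightarrow> value_at X x V s = \<zero>\<^bsub>residue_field X x\<^esub>"
  by (simp add: vanishing_ideal_def value_zero_iff)

lemma affine_opn: "affine_open X V \<Longrightarrow> opn V"
  by (simp add: affine_open_def)

lemma affine_homeomorphic:
  "affine_open X V \<Longrightarrow> homeomorphic_map (subtopology (top_of X) V) (zariski (sections X V)) (vanishing_ideal V)"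
  unfolding affine_open_def vanishing_ideal_def by (elim conjE)

lemma topspace_affine: "affine_open X V \<Longrightarrow> topspace (subtopology (top_of X) V) = V"
  using affine_opn openin_subset by (fastforce simp: topspace_subtopology)

lemma vanishing_ideal_Spec:
  assumes "affine_open X V" "x \<in> V"
  shows "vanishing_ideal V x \<in> Spec (sections X V)"
proof -
  have "vanishing_ideal V ` V = topspace (zariski (sections X V))"
    using homeomorphic_imp_surjective_map[OF affine_homeomorphic[OF assms(1)]]
    by (simp only: topspace_affine[OF assms(1)])
  then show ?thesis
    using assms(2) unfolding topspace_zariski[OF sections_cring[OF affine_opn[OF assms(1)]]] by blast
qed

text \<open>Surjectivity of the chart map. The generic point and the centers are both constructed
  from prime ideals through this lemma.\<close>

lemma prime_imp_point:
  assumes V: "affine_open X V" and Q: "primeideal Q (sections X V)"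
  obtains x where "x \<in> V" "vanishing_ideal V x = Q"
proof -
  have "vanishing_ideal V ` V = Spec (sections X V)"
    using homeomorphic_imp_surjective_map[OF affine_homeomorphic[OF V]]
    by (simp only: topspace_affine[OF V] topspace_zariski[OF sections_cring[OF affine_opn[OF V]]])
  then have "Q \<in> vanishing_ideal V ` V" using Q by (simp add: Spec_def)
  then show ?thesis using that by blast
qed

text \<open>Injectivity of the chart map, with membership in the prime ideal phrased as vanishing of
  values.\<close>

lemma affine_point_eqI:
  assumes V: "affine_open X V" "x \<in> V" "y \<in> V"
    and "\<And>s. s \<in> Sec V \<Longrightarrow> value_at X x V s = \<zero>\<^bsub>residue_field X x\<^esub> \<longleftrightarrow> value_at X y V s = \<zero>\<^bsub>residue_field X y\<^esub>"
  shows "x = y"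
proof -
  have "vanishing_ideal V x = vanishing_ideal V y"
    using assms(4) value_zero_iff[OF affine_opn[OF V(1)] V(2)] value_zero_iff[OF affine_opn[OF V(1)] V(3)]
    unfolding vanishing_ideal_def by auto
  moreover have "inj_on (vanishing_ideal V) V"
    using homeomorphic_imp_injective_map[OF affine_homeomorphic[OF V(1)]] by (simp only: topspace_affine[OF V(1)])
  ultimately show ?thesis
    using V(2,3) by (simp add: inj_on_eq_iff)
qed

lemma nonvanishing_vanishing: "s \<in> Sec V \<Longrightarrow> nonvanishing X V s = {x \<in> V. s \<notin> vanishing_ideal V x}"
  by (auto simp: nonvanishing_def vanishing_ideal_def)

lemma affine_nonvanishing_opn:
  assumes V: "affine_open X V" and h: "h \<in> Sec V"
  shows "opn (nonvanishing X V h)"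
proof -
  have "openin (subtopology (top_of X) V)
      {x \<in> topspace (subtopology (top_of X) V). vanishing_ideal V x \<in> {P \<in> Spec (sections X V). h \<notin> P}}"
    using homeomorphic_imp_continuous_map[OF affine_homeomorphic[OF V]] openin_zariski[OF h]
    by (rule openin_continuous_map_preimage)
  moreover have "{x \<in> topspace (subtopology (top_of X) V). vanishing_ideal V x \<in> {P \<in> Spec (sections X V). h \<notin> P}}
      = nonvanishing X V h"
    unfolding topspace_affine[OF V] using vanishing_ideal_Spec[OF V] h
    by (auto simp: nonvanishing_vanishing)
  ultimately show ?thesis
    using openin_trans_full[OF _ affine_opn[OF V]] by simp
qed

text \<open>The chart map is open, so the image of \<open>U \<inter> V\<close> contains a basic open
  set around the image of \<open>x\<close>; injectivity of the chart map carries the inclusion back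
  to points.\<close>

lemma affine_basis:
  assumes V: "affine_open X V" and U: "opn U" and x: "x \<in> U" "x \<in> V"
  obtains h where "h \<in> Sec V" "x \<in> nonvanishing X V h" "nonvanishing X V h \<subseteq> U"
proof -
  have o: "openin (subtopology (top_of X) V) (U \<inter> V)"
    using U by (auto simp: openin_subtopology)
  have "openin (zariski (sections X V)) (vanishing_ideal V ` (U \<inter> V))"
    using homeomorphic_imp_open_map[OF affine_homeomorphic[OF V]] o
    by (auto simp: open_map_def)
  from zariski_basis[OF sections_cring[OF affine_opn[OF V]] this, of "vanishing_ideal V x"] x
  obtain h where h: "h \<in> Sec V" "h \<notin> vanishing_ideal V x"
      "{Q \<in> Spec (sections X V). h \<notin> Q} \<subseteq> vanishing_ideal V ` (U \<inter> V)"
    by auto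
  have inj: "inj_on (vanishing_ideal V) V"
    using homeomorphic_imp_injective_map[OF affine_homeomorphic[OF V]] topspace_affine[OF V] by simp
  have "nonvanishing X V h \<subseteq> U"
  proof
    fix x' assume x': "x' \<in> nonvanishing X V h"
    then have "vanishing_ideal V x' \<in> vanishing_ideal V ` (U \<inter> V)"
      using h vanishing_ideal_Spec[OF V] by (auto simp: nonvanishing_vanishing)
    then show "x' \<in> U"
      using inj x' nonvanishing_subset[of V h] unfolding inj_on_def by blast
  qed
  then show ?thesis using that h x by (auto simp: nonvanishing_vanishing)
qed

text \<open>By the localization clause of \<open>affine_open\<close>, \<open>s\<close> restricted to
  D(h) is a fraction a / h^n. The identity is given at every point of D(h) because it is also
  applied away from \<open>x\<close>, at generizations of \<open>x\<close> such as the generic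
  point.\<close>

lemma affine_fraction:
  assumes V: "affine_open X V" and U: "opn U" and x: "x \<in> U" "x \<in> V" and s: "s \<in> Sec U"
  obtains h a and n :: nat where "h \<in> Sec V" "a \<in> Sec V" "x \<in> nonvanishing X V h" "nonvanishing X V h \<subseteq> U"
    "\<And>x'. x' \<in> nonvanishing X V h \<Longrightarrow>
       germ X x' V h [^]\<^bsub>stalk X x'\<^esub> n \<otimes>\<^bsub>stalk X x'\<^esub> germ X x' U s = germ X x' V a"
proof -
  obtain h where h: "h \<in> Sec V" "x \<in> nonvanishing X V h" "nonvanishing X V h \<subseteq> U"
    using affine_basis[OF V U x] .
  let ?D = "nonvanishing X V h"
  note oV = affine_opn[OF V]
  have D: "opn ?D" "?D \<subseteq> V" using affine_nonvanishing_opn[OF V h(1)] nonvanishing_subset by auto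
  have "is_localization_away (sections X V) h (sections X ?D) (res X V ?D)"
    using V h by (auto simp: affine_open_def)
  moreover have "res X U ?D s \<in> Sec ?D" by (rule res_closed[OF U D(1) h(3) s])
  ultimately obtain a n where a: "a \<in> Sec V"
      "res X V ?D h [^]\<^bsub>sections X ?D\<^esub> (n::nat) \<otimes>\<^bsub>sections X ?D\<^esub> res X U ?D s = res X V ?D a"
    unfolding is_localization_away_def by blast
  have "germ X x' V h [^]\<^bsub>stalk X x'\<^esub> n \<otimes>\<^bsub>stalk X x'\<^esub> germ X x' U s = germ X x' V a"
    if x': "x' \<in> ?D" for x'
  proof -
    have c: "res X V ?D h \<in> Sec ?D" "res X U ?D s \<in> Sec ?D"
      using res_closed[OF U D(1) h(3) s] res_closed[OF oV D h(1)] by auto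
    have "germ X x' V a = germ X x' ?D (res X V ?D a)"
      using germ_res oV D x' a by simp
    also have "\<dots> = germ X x' ?D (res X V ?D h) [^]\<^bsub>stalk X x'\<^esub> n \<otimes>\<^bsub>stalk X x'\<^esub> germ X x' ?D (res X U ?D s)"
      unfolding a(2)[symmetric]
      using ring_hom_mult[OF germ_hom[OF D(1) x'] pow_closed[OF D(1) c(1)] c(2)] germ_pow[OF D(1) x' c(1)]
      by simp
    also have "\<dots> = germ X x' V h [^]\<^bsub>stalk X x'\<^esub> n \<otimes>\<^bsub>stalk X x'\<^esub> germ X x' U s"
      using germ_res[OF oV D x' h(1)] germ_res[OF U D(1) h(3) x' s] by simp
    finally show ?thesis by simp
  qed
  then show ?thesis using that h a by blast
qed

lemma value_of_germ_eq:
  assumes "opn V" "opn U" "x \<in> U" "x \<in> V" "h \<in> Sec V" "s \<in> Sec U" "a \<in> Sec V"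
    and eq: "germ X x V h [^]\<^bsub>stalk X x\<^esub> (n::nat) \<otimes>\<^bsub>stalk X x\<^esub> germ X x U s = germ X x V a"
  shows "value_at X x V h [^]\<^bsub>residue_field X x\<^esub> n \<otimes>\<^bsub>residue_field X x\<^esub> value_at X x U s = value_at X x V a"
proof -
  have x: "x \<in> points X" by (rule opn_points[OF assms(1,4)])
  have c: "germ X x V h \<in> carrier (stalk X x)" "germ X x U s \<in> carrier (stalk X x)"
    by (rule ring_hom_closed[OF germ_hom]; fact)+
  then have c': "germ X x V h [^]\<^bsub>stalk X x\<^esub> n \<in> carrier (stalk X x)"
    by (intro monoid.nat_pow_closed[OF ring.is_monoid[OF stalk_ring[OF x]]])
  show ?thesis
    unfolding value_at_def eq[symmetric]
    using ring_hom_mult[OF coset_hom[OF x] c' c(2)]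
      ring_hom_nat_pow[OF stalk_ring[OF x] residue_field_ring[OF x] coset_hom[OF x] c(1)]
    by simp
qed

end

section \<open>Nonvanishing loci and specialization on a scheme\<close>

locale local_scheme = local_ringed X for X :: "('a, 'r) ringed_space" +
  assumes scheme: "scheme X"
begin

lemma affine_nbhd:
  assumes "x \<in> points X"
  obtains V where "affine_open X V" "x \<in> V"
  using scheme assms by (auto simp: scheme_def)

text \<open>Openness is local: on a basic open set D(h) of a chart, \<open>s\<close> equals a / h^n,
  so \<open>s\<close> and \<open>a\<close> have the same nonvanishing points there and the affine
  case applies to \<open>a\<close>.\<close>

lemma nonvanishing_opn:
  assumes U: "opn U" and s: "s \<in> Sec U"
  shows "opn (nonvanishing X U s)"
proof (subst openin_subopen, intro ballI)
  fix x assume x: "x \<in> nonvanishing X U s"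
  then have xU: "x \<in> U" using nonvanishing_subset by blast
  then obtain V where V: "affine_open X V" "x \<in> V" using affine_nbhd[OF opn_points[OF U]] by blast
  note oV = affine_opn[OF V(1)]
  obtain h a n where h: "h \<in> Sec V" "a \<in> Sec V" "x \<in> nonvanishing X V h" "nonvanishing X V h \<subseteq> U"
    and eq: "\<And>x'. x' \<in> nonvanishing X V h \<Longrightarrow>
       germ X x' V h [^]\<^bsub>stalk X x'\<^esub> (n::nat) \<otimes>\<^bsub>stalk X x'\<^esub> germ X x' U s = germ X x' V a"
    by (rule affine_fraction[OF V(1) U xU V(2) s]) blast
  have *: "x' \<in> nonvanishing X U s \<longleftrightarrow> x' \<in> nonvanishing X V a" if x': "x' \<in> nonvanishing X V h" for x'
  proof -
    have xx: "x' \<in> V" "x' \<in> U" using x' h nonvanishing_subset by auto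
    interpret field "residue_field X x'" by (rule residue_field_field[OF opn_points[OF U xx(2)]])
    show ?thesis
      using value_of_germ_eq[OF oV U xx(2,1) h(1) s h(2) eq[OF x']] x' xx oV U s h
        pow_mult_zero_iff[of "value_at X x' V h" "value_at X x' U s" n]
      by (simp add: nonvanishing_iff value_closed)
  qed
  show "\<exists>T. opn T \<and> x \<in> T \<and> T \<subseteq> nonvanishing X U s"
    using * x h affine_nonvanishing_opn[OF V(1)]
    by (intro exI[of _ "nonvanishing X V h \<inter> nonvanishing X V a"]) auto
qed

lemma closure_pt_opn: "z \<in> closure_pt X y \<Longrightarrow> opn U \<Longrightarrow> z \<in> U \<Longrightarrow> y \<in> U"
  by (auto simp: in_closure_of)

text \<open>A section with nonzero value at \<open>z\<close> is nonzero on an open set around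
  \<open>z\<close>, and this set contains the generization \<open>y\<close>.\<close>

lemma value_zero_specialization:
  assumes "z \<in> closure_pt X y" "opn U" "z \<in> U" "s \<in> Sec U"
    and "value_at X y U s = \<zero>\<^bsub>residue_field X y\<^esub>"
  shows "value_at X z U s = \<zero>\<^bsub>residue_field X z\<^esub>"
  using closure_pt_opn[OF assms(1) nonvanishing_opn[OF assms(2,4)]] assms nonvanishing_iff by blast

end

section \<open>Integral schemes\<close>

lemma ring_hom_minus:
  assumes "ring R" "ring S" "h \<in> ring_hom R S" "x \<in> carrier R" "y \<in> carrier R"
  shows "h (x \<ominus>\<^bsub>R\<^esub> y) = h x \<ominus>\<^bsub>S\<^esub> h y"
proof -
  interpret ring_hom_ring R S h
    using assms by (intro ring_hom_ringI2)
  show ?thesis using assms(4,5) by (simp add: R.minus_eq S.minus_eq)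
qed

section \<open>Gluing of sections\<close>

context local_ringed begin

lemma sheaf_axioms:
  assumes "\<forall>U \<in> \<U>. opn U"
  shows "(\<forall>s \<in> Sec (\<Union>\<U>). \<forall>t \<in> Sec (\<Union>\<U>).
           (\<forall>U \<in> \<U>. res X (\<Union>\<U>) U s = res X (\<Union>\<U>) U t) \<longrightarrow> s = t) \<and>
        (\<forall>f. (\<forall>U \<in> \<U>. f U \<in> Sec U) \<longrightarrow>
           (\<forall>U \<in> \<U>. \<forall>V \<in> \<U>. res X U (U \<inter> V) (f U) = res X V (U \<inter> V) (f V)) \<longrightarrow>
           (\<exists>s \<in> Sec (\<Union>\<U>). \<forall>U \<in> \<U>. res X (\<Union>\<U>) U s = f U))"
  using lrs unfolding locally_ringed_space_def sheaf_of_rings_def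
  by (elim conjE) (drule spec[of _ \<U>], erule mp[OF _ assms])

lemma sheaf_separated:
  assumes U: "\<forall>U \<in> \<U>. opn U" and "s \<in> Sec (\<Union>\<U>)" "t \<in> Sec (\<Union>\<U>)"
    and "\<forall>U \<in> \<U>. res X (\<Union>\<U>) U s = res X (\<Union>\<U>) U t"
  shows "s = t"
  using conjunct1[OF sheaf_axioms[OF U]] assms(2-4) by blast

lemma sheaf_glue:
  assumes U: "\<forall>U \<in> \<U>. opn U" and "\<forall>U \<in> \<U>. f U \<in> Sec U"
    and "\<forall>U \<in> \<U>. \<forall>V \<in> \<U>. res X U (U \<inter> V) (f U) = res X V (U \<inter> V) (f V)"
  obtains s where "s \<in> Sec (\<Union>\<U>)" "\<forall>U \<in> \<U>. res X (\<Union>\<U>) U s = f U"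
  using mp[OF mp[OF spec[OF conjunct2[OF sheaf_axioms[OF U]]] assms(2)] assms(3)] that by blast

text \<open>The empty family covers the empty set, so agreement on the cover is vacuous.\<close>

lemma sections_empty_eq: "s \<in> Sec {} \<Longrightarrow> t \<in> Sec {} \<Longrightarrow> s = t"
  using sheaf_separated[of "{}" s t] by simp

lemma glue_disjoint:
  assumes U: "opn U" "opn V" "U \<inter> V = {}" "U \<noteq> V" and s: "s \<in> Sec U" "t \<in> Sec V"
  obtains r where "r \<in> Sec (U \<union> V)" "res X (U \<union> V) U r = s" "res X (U \<union> V) V r = t"
proof -
  \<comment> \<open>For disjoint sets \<open>U \<noteq> V\<close> only excludes that both are empty;
    it keeps this choice from assigning \<open>s\<close> to \<open>V\<close>.\<close>
  let ?f = "\<lambda>W. if W = U then s else t"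
  have e: "res X U {} s = res X V {} t"
    using res_closed[OF U(1) _ _ s(1), of "{}"] res_closed[OF U(2) _ _ s(2), of "{}"]
    by (intro sections_empty_eq) auto
  have "V \<inter> U = {}" using U(3) by blast
  then have c: "\<forall>W \<in> {U, V}. \<forall>W' \<in> {U, V}. res X W (W \<inter> W') (?f W) = res X W' (W \<inter> W') (?f W')"
    using U(3,4) e by simp
  have o: "\<forall>W \<in> {U, V}. opn W" and f: "\<forall>W \<in> {U, V}. ?f W \<in> Sec W"
    using U s by simp_all
  obtain r where "r \<in> Sec (\<Union>{U, V})" "\<forall>W \<in> {U, V}. res X (\<Union>{U, V}) W r = ?f W"
    by (rule sheaf_glue[OF o f c])
  then show ?thesis
    using U(4) by (intro that[of r]) simp_all
qed

end

section \<open>Irreducibility, vanishing of germs and the generic point\<close>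

locale integral_local_scheme = local_scheme X for X :: "('a, 'r) ringed_space" +
  assumes integral: "integral_scheme X"
begin

lemma sections_domain: "opn U \<Longrightarrow> U \<noteq> {} \<Longrightarrow> domain (sections X U)"
  using integral by (simp add: integral_scheme_def)

lemma irreducible:
  assumes "opn U" "U \<noteq> {}" "opn V" "V \<noteq> {}"
  shows "U \<inter> V \<noteq> {}"
proof
  assume dis: "U \<inter> V = {}"
  \<comment> \<open>the complementary idempotents on \<open>U \<union> V\<close> are zero divisors\<close>
  have ne: "U \<noteq> V" using dis assms by auto
  let ?W = "U \<union> V"
  have W: "opn ?W" "U \<subseteq> ?W" "V \<subseteq> ?W" using assms by auto
  interpret U: domain "sections X U" by (rule sections_domain) fact+
  interpret V: domain "sections X V" by (rule sections_domain) fact+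
  interpret W: domain "sections X ?W" by (rule sections_domain) (use W assms in auto)
  obtain e where e: "e \<in> Sec ?W" "res X ?W U e = \<one>\<^bsub>sections X U\<^esub>" "res X ?W V e = \<zero>\<^bsub>sections X V\<^esub>"
    by (rule glue_disjoint[OF assms(1,3) dis ne U.one_closed V.zero_closed])
  obtain e' where e': "e' \<in> Sec ?W" "res X ?W U e' = \<zero>\<^bsub>sections X U\<^esub>" "res X ?W V e' = \<one>\<^bsub>sections X V\<^esub>"
    by (rule glue_disjoint[OF assms(1,3) dis ne U.zero_closed V.one_closed])
  note hU = res_hom[OF W(1) assms(1) W(2)] and hV = res_hom[OF W(1) assms(3) W(3)]
  note zU = ring_hom_zero[OF hU W.ring_axioms U.ring_axioms]
    and zV = ring_hom_zero[OF hV W.ring_axioms V.ring_axioms]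
  have "e \<otimes>\<^bsub>sections X ?W\<^esub> e' = \<zero>\<^bsub>sections X ?W\<^esub>"
  proof (rule sheaf_separated[of "{U, V}"])
    show "\<forall>A \<in> {U, V}. res X (\<Union> {U, V}) A (e \<otimes>\<^bsub>sections X ?W\<^esub> e') = res X (\<Union> {U, V}) A \<zero>\<^bsub>sections X ?W\<^esub>"
      using ring_hom_mult[OF hU e(1) e'(1)] ring_hom_mult[OF hV e(1) e'(1)] e e' zU zV by auto
  qed (use assms e e' in auto)
  then have "e = \<zero>\<^bsub>sections X ?W\<^esub> \<or> e' = \<zero>\<^bsub>sections X ?W\<^esub>"
    using W.integral e(1) e'(1) by blast
  then show False
    using e e' zU zV U.one_not_zero V.one_not_zero by auto
qed

lemma affine_zeroI:
  assumes V: "affine_open X V" "V \<noteq> {}" and s: "s \<in> Sec V" and D: "nonvanishing X V s = {}"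
  shows "s = \<zero>\<^bsub>sections X V\<^esub>"
proof (rule ccontr)
  assume nz: "s \<noteq> \<zero>\<^bsub>sections X V\<^esub>"
  interpret domain "sections X V" using sections_domain affine_opn V by simp
  \<comment> \<open>the localization at \<open>s\<close> is the ring of sections over the empty set, in which \<open>1 = 0\<close>\<close>
  have "is_localization_away (sections X V) s (sections X {}) (res X V {})"
    using V(1) s D by (auto simp: affine_open_def)
  moreover have "res X V {} \<one>\<^bsub>sections X V\<^esub> = \<zero>\<^bsub>sections X {}\<^esub>"
    using res_closed[OF affine_opn[OF V(1)] openin_empty] local_ringed.zero_closed[OF local_ringed_axioms openin_empty]
    by (intro sections_empty_eq) auto
  ultimately obtain n where "s [^]\<^bsub>sections X V\<^esub> (n::nat) \<otimes>\<^bsub>sections X V\<^esub> \<one>\<^bsub>sections X V\<^esub> = \<zero>\<^bsub>sections X V\<^esub>"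
    unfolding is_localization_away_def by blast
  then show False using nat_pow_nonzero[OF s nz] s by simp
qed

text \<open>The localization clause makes \<open>h\<close> a unit over D(h), and the homomorphism to
  the stalk preserves units.\<close>

lemma affine_germ_Units:
  assumes V: "affine_open X V" and h: "h \<in> Sec V" and x: "x \<in> nonvanishing X V h"
  shows "germ X x V h \<in> Units (stalk X x)"
proof -
  let ?D = "nonvanishing X V h"
  note oV = affine_opn[OF V]
  have D: "opn ?D" "?D \<subseteq> V" using affine_nonvanishing_opn[OF V h] nonvanishing_subset by auto
  have px: "x \<in> points X" using opn_points[OF D(1) x] .
  have "is_localization_away (sections X V) h (sections X ?D) (res X V ?D)"
    using V h by (auto simp: affine_open_def)
  then have "res X V ?D h \<in> Units (sections X ?D)" by (simp add: is_localization_away_def)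
  then obtain k where k: "k \<in> Sec ?D" "res X V ?D h \<in> Sec ?D" 
      "res X V ?D h \<otimes>\<^bsub>sections X ?D\<^esub> k = \<one>\<^bsub>sections X ?D\<^esub>"
    by (auto simp: Units_def)
  note g = germ_hom[OF D(1) x]
  interpret cring "stalk X x" by (rule stalk_cring[OF px])
  have "germ X x V h \<otimes>\<^bsub>stalk X x\<^esub> germ X x ?D k = \<one>\<^bsub>stalk X x\<^esub>"
    using ring_hom_mult[OF g k(2,1)] ring_hom_one[OF g] germ_res[OF oV D x h] k(3) by simp
  then show ?thesis
    using ring_hom_closed[OF g k(1)] ring_hom_closed[OF g k(2)] germ_res[OF oV D x h]
    unfolding Units_def by (auto intro!: bexI[of _ "germ X x ?D k"] simp: m_comm)
qed

text \<open>The section vanishes on a neighbourhood \<open>W\<close> of \<open>x\<close>. Near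
  \<open>y\<close> it is a fraction a / h^n on a chart. If D(a) were nonempty, irreducibility would
  give a common point of D(a), D(h) and \<open>W\<close>, where \<open>a\<close> has value zero, a
  contradiction. So \<open>a\<close> is zero by \<open>affine_zeroI\<close>, and the unit h^n
  cancels in the stalk at \<open>y\<close>.\<close>

lemma germ_zero_everywhere:
  assumes U: "opn U" and s: "s \<in> Sec U" and x: "x \<in> U" "germ X x U s = \<zero>\<^bsub>stalk X x\<^esub>"
    and y: "y \<in> U"
  shows "germ X y U s = \<zero>\<^bsub>stalk X y\<^esub>"
proof -
  have "germ X x U s = germ X x U \<zero>\<^bsub>sections X U\<^esub>"
    using germ_zero[OF U x(1)] x by simp
  then obtain W where W: "opn W" "x \<in> W" "W \<subseteq> U" "res X U W s = res X U W \<zero>\<^bsub>sections X U\<^esub>"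
    by (rule germ_eqD[OF _ U x(1) zero_closed[OF U]])
  have v0: "value_at X x' U s = \<zero>\<^bsub>residue_field X x'\<^esub>" if "x' \<in> W" for x'
    using value_res[OF U W(1,3) that s] value_res[OF U W(1,3) that zero_closed[OF U]] W(4)
      value_zero[OF U subsetD[OF W(3) that]] by simp
  have "y \<in> points X" using opn_points[OF U y] .
  then obtain V where V: "affine_open X V" "y \<in> V" by (rule affine_nbhd)
  note oV = affine_opn[OF V(1)]
  obtain h a n where h: "h \<in> Sec V" "a \<in> Sec V" "y \<in> nonvanishing X V h" "nonvanishing X V h \<subseteq> U"
    and eq: "\<And>x'. x' \<in> nonvanishing X V h \<Longrightarrow>
       germ X x' V h [^]\<^bsub>stalk X x'\<^esub> (n::nat) \<otimes>\<^bsub>stalk X x'\<^esub> germ X x' U s = germ X x' V a"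
    by (rule affine_fraction[OF V(1) U y V(2) s]) blast
  have "nonvanishing X V a = {}"
  proof (rule ccontr)
    assume "nonvanishing X V a \<noteq> {}"
    then have "nonvanishing X V a \<inter> nonvanishing X V h \<noteq> {}"
      using irreducible affine_nonvanishing_opn[OF V(1)] h by blast
    moreover have o: "opn (nonvanishing X V a \<inter> nonvanishing X V h)"
      using affine_nonvanishing_opn[OF V(1)] h by blast
    ultimately obtain x' where x': "x' \<in> W" "x' \<in> nonvanishing X V a" "x' \<in> nonvanishing X V h"
      using irreducible[OF _ _ W(1)] W(2) by blast
    then have xx: "x' \<in> V" "x' \<in> U" using h nonvanishing_subset by auto
    interpret field "residue_field X x'" by (rule residue_field_field[OF opn_points[OF U xx(2)]])
    show False
      using value_of_germ_eq[OF oV U xx(2,1) h(1) s h(2) eq[OF x'(3)]] x' xx oV U s h v0[OF x'(1)]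
      by (simp add: nonvanishing_iff value_closed)
  qed
  then have a0: "a = \<zero>\<^bsub>sections X V\<^esub>"
    using affine_zeroI[OF V(1)] V h by blast
  interpret cring "stalk X y" by (rule stalk_cring[OF opn_points[OF U y]])
  have u: "germ X y V h [^]\<^bsub>stalk X y\<^esub> n \<in> Units (stalk X y)"
    by (intro Units_pow_closed affine_germ_Units[OF V(1) h(1,3)])
  have c: "germ X y U s \<in> carrier (stalk X y)" by (rule ring_hom_closed[OF germ_hom[OF U y] s])
  have "germ X y V h [^]\<^bsub>stalk X y\<^esub> n \<otimes>\<^bsub>stalk X y\<^esub> germ X y U s =
      germ X y V h [^]\<^bsub>stalk X y\<^esub> n \<otimes>\<^bsub>stalk X y\<^esub> \<zero>\<^bsub>stalk X y\<^esub>"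
    using eq[OF h(3)] germ_zero[OF oV V(2)] a0 u Units_closed by simp
  then show ?thesis using Units_l_cancel[OF u c zero_closed] by simp
qed

text \<open>The vanishing lemma applied to the difference on the overlap. Taking the generic point
  for \<open>x\<close> shows that the stalks embed in the function field.\<close>

lemma germ_eq_everywhere:
  assumes U: "opn U" "s \<in> Sec U" and V: "opn V" "t \<in> Sec V"
    and x: "x \<in> U" "x \<in> V" "germ X x U s = germ X x V t" and y: "y \<in> U" "y \<in> V"
  shows "germ X y U s = germ X y V t"
proof -
  let ?W = "U \<inter> V"
  have W: "opn ?W" "?W \<subseteq> U" "?W \<subseteq> V" using U V by auto
  define s' t' where "s' = res X U ?W s" and "t' = res X V ?W t"
  have c: "s' \<in> Sec ?W" "t' \<in> Sec ?W"
    unfolding s'_def t'_def using res_closed U V W by blast+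
  have g: "germ X z U s = germ X z ?W s'" "germ X z V t = germ X z ?W t'" if "z \<in> ?W" for z
    unfolding s'_def t'_def using germ_res[OF U(1) W(1,2) that U(2)] germ_res[OF V(1) W(1,3) that V(2)] by auto
  interpret W: ring "sections X ?W" by (rule sections_ring[OF W(1)])
  have m: "germ X z ?W (s' \<ominus>\<^bsub>sections X ?W\<^esub> t') = \<zero>\<^bsub>stalk X z\<^esub> \<longleftrightarrow> germ X z U s = germ X z V t"
    if z: "z \<in> ?W" for z
  proof -
    interpret Z: ring "stalk X z" by (rule stalk_ring[OF opn_points[OF W(1) z]])
    show ?thesis
      unfolding g[OF z] ring_hom_minus[OF W.ring_axioms Z.ring_axioms germ_hom[OF W(1) z] c]
      using ring_hom_closed[OF germ_hom[OF W(1) z]] c by simp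
  qed
  show ?thesis
    using germ_zero_everywhere[OF W(1) W.minus_closed[OF c], of x y] m x y by auto
qed

lemma closure_pt_eq_points:
  assumes "closure_pt X y = points X" "opn U" "U \<noteq> {}"
  shows "y \<in> U"
proof -
  obtain z where z: "z \<in> U" using assms by blast
  then have "z \<in> closure_pt X y" using assms opn_points by blast
  then show ?thesis using closure_pt_opn assms(2) z by blast
qed

text \<open>The zero ideal of the domain of sections over a chart \<open>V\<close> gives a point
  \<eta>. Every nonempty open set contains some nonempty D(h) with \<open>h\<close> nonzero, hence
  contains \<eta>. Two points with dense closure lie in the same nonempty open sets, so the same
  sections vanish at both and the chart identifies them.\<close>

lemma generic_point_ex1: "\<exists>!x. x \<in> points X \<and> closure_pt X x = points X"
proof -
  obtain x0 where "x0 \<in> points X" using integral unfolding integral_scheme_def by blast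
  then obtain V where V: "affine_open X V" "x0 \<in> V" by (rule affine_nbhd)
  note oV = affine_opn[OF V(1)]
  interpret domain "sections X V" using sections_domain oV V(2) by blast
  obtain \<eta> where \<eta>: "\<eta> \<in> V" "vanishing_ideal V \<eta> = {\<zero>\<^bsub>sections X V\<^esub>}"
    using prime_imp_point[OF V(1) zeroprimeideal] .
  have "\<eta> \<in> T" if T: "opn T" "z \<in> T" for z T
  proof -
    obtain x1 where x1: "x1 \<in> T" "x1 \<in> V" using irreducible[OF T(1) _ oV] T V by blast
    obtain h where h: "h \<in> Sec V" "x1 \<in> nonvanishing X V h" "nonvanishing X V h \<subseteq> T"
      using affine_basis[OF V(1) T(1) x1] .
    have "h \<noteq> \<zero>\<^bsub>sections X V\<^esub>"
      using h(1,2) value_zero[OF oV x1(2)] nonvanishing_iff[OF oV h(1)] by auto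
    then show ?thesis using \<eta> h by (auto simp: nonvanishing_vanishing)
  qed
  then have cl: "closure_pt X \<eta> = points X"
    by (auto simp: in_closure_of)
  show ?thesis
  proof (rule ex1I[of _ \<eta>])
    show "\<eta> \<in> points X \<and> closure_pt X \<eta> = points X" using cl \<eta> opn_points[OF oV] by simp
    fix y assume y: "y \<in> points X \<and> closure_pt X y = points X"
    then have yV: "y \<in> V" using closure_pt_eq_points[OF _ oV] V by blast
    show "y = \<eta>"
    proof (rule affine_point_eqI[OF V(1) yV \<eta>(1)])
      fix s assume s: "s \<in> Sec V"
      have o: "opn (nonvanishing X V s)" by (rule affine_nonvanishing_opn[OF V(1) s])
      have "y \<in> nonvanishing X V s \<longleftrightarrow> \<eta> \<in> nonvanishing X V s"
        using closure_pt_eq_points[OF _ o] y cl by blast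
      then show "value_at X y V s = \<zero>\<^bsub>residue_field X y\<^esub> \<longleftrightarrow> value_at X \<eta> V s = \<zero>\<^bsub>residue_field X \<eta>\<^esub>"
        using nonvanishing_iff[OF oV s] yV \<eta> by blast
    qed
  qed
qed

lemma generic_point_in: "opn U \<Longrightarrow> U \<noteq> {} \<Longrightarrow> generic_point X \<in> U"
  unfolding generic_point_def by (rule closure_pt_eq_points[OF conjunct2[OF theI'[OF generic_point_ex1]]])

end

section \<open>Centers of semivaluations\<close>

locale field_valuation = field K for K :: "('k, 'm) ring_scheme" (structure) +
  fixes w :: "'k \<Rightarrow> ereal"
  assumes valuation: "valuation K w"
begin

lemma val_mult: "a \<in> carrier K \<Longrightarrow> b \<in> carrier K \<Longrightarrow> w (a \<otimes> b) = w a + w b"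
  using valuation by (simp add: valuation_def)

lemma val_not_MInf: "a \<in> carrier K \<Longrightarrow> w a \<noteq> -\<infinity>"
  using valuation by (simp add: valuation_def)

lemma val_eq_PInf_iff: "a \<in> carrier K \<Longrightarrow> w a = \<infinity> \<longleftrightarrow> a = \<zero>"
  using valuation by (simp add: valuation_def)

lemma val_add: "a \<in> carrier K \<Longrightarrow> b \<in> carrier K \<Longrightarrow> min (w a) (w b) \<le> w (a \<oplus> b)"
  using valuation by (simp add: valuation_def)

lemma val_finite:
  assumes "a \<in> carrier K" "a \<noteq> \<zero>"
  obtains r where "w a = ereal r"
  using val_not_MInf[OF assms(1)] val_eq_PInf_iff[OF assms(1)] assms(2) that by (cases "w a") auto

lemma val_one: "w \<one> = 0"
proof -
  obtain r where r: "w \<one> = ereal r" using val_finite[OF one_closed one_not_zero] .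
  then show ?thesis using val_mult[OF one_closed one_closed] by simp
qed

lemma val_uminus: "a \<in> carrier K \<Longrightarrow> w (\<ominus> a) = w a"
proof -
  assume a: "a \<in> carrier K"
  have "\<ominus> \<one> \<noteq> \<zero>" using one_not_zero minus_minus[OF one_closed] minus_zero by auto
  then obtain r where r: "w (\<ominus> \<one>) = ereal r" using val_finite[of "\<ominus> \<one>"] by auto
  have "w \<one> = w (\<ominus> \<one>) + w (\<ominus> \<one>)" using val_mult[of "\<ominus> \<one>" "\<ominus> \<one>"] by (simp add: l_minus)
  then have "w (\<ominus> \<one>) = 0" using r val_one by simp
  then show ?thesis using val_mult[of "\<ominus> \<one>" a] a by (simp add: l_minus)
qed

lemma val_pow: "a \<in> carrier K \<Longrightarrow> w (a [^] (n::nat)) = ereal (real n) * w a"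
proof (induction n)
  case 0
  \<comment> \<open>For a = 0 and exponent 0 the formula rests on the convention 0 * \<infinity> = 0
    of \<open>ereal\<close>.\<close>
  then show ?case using val_one by (simp flip: zero_ereal_def)
next
  case (Suc n)
  then have "w (a [^] Suc n) = ereal (real n) * w a + w a"
    using val_mult[of "a [^] n" a] by simp
  then show ?case
    using val_not_MInf[OF Suc.prems] by (cases "w a") (auto simp: algebra_simps)
qed

lemma val_pow_zero: "a \<in> carrier K \<Longrightarrow> w a = 0 \<Longrightarrow> w (a [^] (n::nat)) = 0"
  by (simp add: val_pow)

text \<open>This is the contraction to \<open>A\<close> of the maximal ideal of the valuation ring;
  primality holds because elements of value 0 have a product of value 0. For \<open>A\<close> the
  sections over a chart it is the prime of the center.\<close>

lemma primeideal_positive: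
  assumes A: "cring A" and \<phi>: "\<phi> \<in> ring_hom A K" and nn: "\<And>s. s \<in> carrier A \<Longrightarrow> 0 \<le> w (\<phi> s)"
  shows "primeideal {s \<in> carrier A. 0 < w (\<phi> s)} A"
proof -
  interpret A: cring A by fact
  interpret \<phi>: ring_hom_ring A K \<phi>
    by (intro ring_hom_ringI2 A.ring_axioms ring_axioms \<phi>)
  have add: "0 < w (\<phi> s \<oplus> \<phi> t)" if "s \<in> carrier A" "t \<in> carrier A" "0 < w (\<phi> s)" "0 < w (\<phi> t)" for s t
    using val_add[of "\<phi> s" "\<phi> t"] that by (simp add: min_def split: if_splits)
  have mult: "0 < w (\<phi> s \<otimes> \<phi> t)" if "s \<in> carrier A" "t \<in> carrier A" "0 < w (\<phi> s)" for s t
    using val_mult[of "\<phi> s" "\<phi> t"] that nn[of t] by (simp add: add_pos_nonneg)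
  show ?thesis
  proof (rule primeidealI[OF idealI])
    show "subgroup {s \<in> carrier A. 0 < w (\<phi> s)} (add_monoid A)"
    proof (rule A.add.subgroupI)
      show "{s \<in> carrier A. 0 < w (\<phi> s)} \<noteq> {}"
        using val_eq_PInf_iff[of \<zero>] by (auto intro!: exI[of _ "\<zero>\<^bsub>A\<^esub>"])
    qed (auto simp: add val_uminus simp flip: a_inv_def)
    show "carrier A \<noteq> {s \<in> carrier A. 0 < w (\<phi> s)}"
      using val_one by (auto simp: set_eq_iff intro!: exI[of _ "\<one>\<^bsub>A\<^esub>"])
    fix a b assume ab: "a \<in> carrier A" "b \<in> carrier A" "a \<otimes>\<^bsub>A\<^esub> b \<in> {s \<in> carrier A. 0 < w (\<phi> s)}"
    then have "w (\<phi> a) \<noteq> 0 \<or> w (\<phi> b) \<noteq> 0" using val_mult[of "\<phi> a" "\<phi> b"] by auto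
    then show "a \<in> {s \<in> carrier A. 0 < w (\<phi> s)} \<or> b \<in> {s \<in> carrier A. 0 < w (\<phi> s)}"
      using nn[OF ab(1)] nn[OF ab(2)] ab by (auto simp: order_le_less)
  qed (use A.ring_axioms A mult in \<open>auto simp: m_comm\<close>)
qed

text \<open>The valuation ring is closed under the ring operations, so generators suffice. This is
  how the surjectivity clause of separatedness enters.\<close>

lemma nonneg_generate_ring:
  assumes A: "cring A" and \<phi>: "\<phi> \<in> ring_hom A K" and H: "H \<subseteq> carrier A"
    and nn: "\<And>s. s \<in> H \<Longrightarrow> 0 \<le> w (\<phi> s)" and s: "s \<in> generate_ring A H"
  shows "0 \<le> w (\<phi> s)"
proof -
  interpret A: cring A by fact
  interpret \<phi>: ring_hom_ring A K \<phi>
    by (intro ring_hom_ringI2 A.ring_axioms ring_axioms \<phi>)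
  note c = A.generate_ring_in_carrier[OF H]
  show ?thesis
    using s
  proof induction
    case (eng_add s t)
    then show ?case
      using val_add[of "\<phi> s" "\<phi> t"] c by (simp add: min_def split: if_splits)
  next
    case (eng_mult s t)
    then show ?case using val_mult[of "\<phi> s" "\<phi> t"] c by simp
  qed (use nn c val_one val_uminus in auto)
qed

end

section \<open>Existence of the center\<close>

context local_scheme begin

text \<open>Vanishing of the difference passes from \<open>y\<close> to \<open>z\<close>. So the
  reduction from the local ring at \<open>z\<close> of the closure of \<open>y\<close> to the
  residue field at \<open>z\<close> is well defined.\<close>

lemma value_eq_specialization:
  assumes z: "z \<in> closure_pt X y" and U: "opn U" "z \<in> U" "s \<in> Sec U" and V: "opn V" "z \<in> V" "t \<in> Sec V"
    and eq: "value_at X y U s = value_at X y V t"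
  shows "value_at X z U s = value_at X z V t"
proof -
  let ?W = "U \<inter> V"
  have W: "opn ?W" "?W \<subseteq> U" "?W \<subseteq> V" "z \<in> ?W" using U V by auto
  have yW: "y \<in> ?W" by (rule closure_pt_opn[OF z W(1,4)])
  define s' t' where "s' = res X U ?W s" and "t' = res X V ?W t"
  have c: "s' \<in> Sec ?W" "t' \<in> Sec ?W"
    unfolding s'_def t'_def by (rule res_closed; use U V W in blast)+
  have g: "value_at X x U s = value_at X x ?W s'" "value_at X x V t = value_at X x ?W t'" if "x \<in> ?W" for x
    unfolding s'_def t'_def using value_res[OF U(1) W(1,2) that U(3)] value_res[OF V(1) W(1,3) that V(3)] by auto
  interpret W: ring "sections X ?W" by (rule sections_ring[OF W(1)])
  have m: "value_at X x ?W (s' \<ominus>\<^bsub>sections X ?W\<^esub> t') = \<zero>\<^bsub>residue_field X x\<^esub> \<longleftrightarrow>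
      value_at X x U s = value_at X x V t" if x: "x \<in> ?W" for x
  proof -
    interpret Z: ring "residue_field X x" by (rule residue_field_ring[OF opn_points[OF W(1) x]])
    show ?thesis
      unfolding g[OF x] ring_hom_minus[OF W.ring_axioms Z.ring_axioms value_hom[OF W(1) x] c]
      using ring_hom_closed[OF value_hom[OF W(1) x]] c by simp
  qed
  show ?thesis
    using value_zero_specialization[OF z W(1,4) W.minus_closed[OF c]] m[OF yW] m[OF W(4)] eq by simp
qed

text \<open>The condition defining the center, rewritten for sections near \<open>z\<close> in place
  of elements of the residue field at \<open>y\<close>.\<close>

definition dominates :: "(('a, 'r) germ set \<Rightarrow> ereal) \<Rightarrow> 'a \<Rightarrow> 'a \<Rightarrow> bool" where
  "dominates w y z \<longleftrightarrow> z \<in> closure_pt X y \<and> (\<forall>U s. opn U \<longrightarrow> z \<in> U \<longrightarrow> s \<in> Sec U \<longrightarrow>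
     0 \<le> w (value_at X y U s) \<and>
     (0 < w (value_at X y U s) \<longleftrightarrow> value_at X z U s = \<zero>\<^bsub>residue_field X z\<^esub>))"

text \<open>The nontrivial point is \<open>max_ideal_closure\<close>, which asks for some
  representative vanishing at \<open>z\<close>; by \<open>value_eq_specialization\<close> then every
  representative vanishes there.\<close>

lemma dominates_iff:
  "z \<in> closure_pt X y \<and> (\<forall>a \<in> local_ring_closure X y z.
      0 \<le> w a \<and> (0 < w a \<longleftrightarrow> a \<in> max_ideal_closure X y z)) \<longleftrightarrow> dominates w y z"
proof (cases "z \<in> closure_pt X y")
  case z: True
  have "value_at X y U s \<in> max_ideal_closure X y z \<longleftrightarrow> value_at X z U s = \<zero>\<^bsub>residue_field X z\<^esub>"
    if U: "opn U" "z \<in> U" "s \<in> Sec U" for U s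
  proof
    assume "value_at X y U s \<in> max_ideal_closure X y z"
    then obtain V t where V: "opn V" "z \<in> V" "t \<in> Sec V" "germ X z V t \<in> max_ideal_at X z"
        "value_at X y U s = value_at X y V t"
      by (auto simp: max_ideal_closure_def)
    then show "value_at X z U s = \<zero>\<^bsub>residue_field X z\<^esub>"
      using value_eq_specialization[OF z U V(1-3,5)] value_zero_iff[OF V(1-3)] by simp
  next
    assume "value_at X z U s = \<zero>\<^bsub>residue_field X z\<^esub>"
    then show "value_at X y U s \<in> max_ideal_closure X y z"
      using value_zero_iff[OF U] U unfolding max_ideal_closure_def by blast
  qed
  note mem = this
  have "(\<forall>a \<in> local_ring_closure X y z. P a) \<longleftrightarrow>
      (\<forall>U s. opn U \<longrightarrow> z \<in> U \<longrightarrow> s \<in> Sec U \<longrightarrow> P (value_at X y U s))" for P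
    unfolding local_ring_closure_def by blast
  then show ?thesis
    unfolding dominates_def using z mem by (simp cong: imp_cong)
qed (simp add: dominates_def)

text \<open>The point \<open>z0\<close> serves to find a chart \<open>V\<close> on whose sections
  \<open>w\<close> is nonnegative. The prime of sections of positive value is a point
  \<open>z\<close> of \<open>V\<close>, and domination is transferred from sections over
  \<open>V\<close> to sections near \<open>z\<close> by writing the latter as fractions.\<close>

lemma dominates_exists:
  assumes val: "valuation (residue_field X y) w" and y: "y \<in> points X" and z0: "z0 \<in> closure_pt X y"
    and nn: "\<And>a. a \<in> local_ring_closure X y z0 \<Longrightarrow> 0 \<le> w a"
  obtains z where "dominates w y z"
proof -
  interpret field_valuation "residue_field X y" w
    by (intro field_valuation.intro residue_field_field y) (unfold_locales, rule val)
  have "z0 \<in> points X" using z0 by (simp add: in_closure_of)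
  then obtain V where V: "affine_open X V" "z0 \<in> V" by (rule affine_nbhd)
  note oV = affine_opn[OF V(1)]
  have yV: "y \<in> V" by (rule closure_pt_opn[OF z0 oV V(2)])
  have nnV: "0 \<le> w (value_at X y V s)" if "s \<in> Sec V" for s
    using that oV V(2) by (intro nn) (auto simp: local_ring_closure_def)
  let ?Q = "{s \<in> Sec V. 0 < w (value_at X y V s)}"
  have "primeideal ?Q (sections X V)"
    by (rule primeideal_positive[OF sections_cring[OF oV] value_hom[OF oV yV] nnV])
  then obtain z where z: "z \<in> V" "vanishing_ideal V z = ?Q"
    using prime_imp_point[OF V(1)] by blast
  have van: "value_at X z V s = \<zero>\<^bsub>residue_field X z\<^esub> \<longleftrightarrow> 0 < w (value_at X y V s)" if "s \<in> Sec V" for s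
    using vanishing_ideal_iff[OF oV z(1) that] z(2) that by simp
  \<comment> \<open>For a basic neighbourhood D(h) of \<open>z\<close>, the value of
    \<open>h\<close> at \<open>y\<close> has no positive valuation. As zero has valuation
    \<infinity>, \<open>h\<close> does not vanish at \<open>y\<close>.\<close>
  have zcl: "z \<in> closure_pt X y"
    unfolding in_closure_of
  proof (intro conjI allI impI)
    show "z \<in> points X" by (rule opn_points[OF oV z(1)])
    fix T assume T: "z \<in> T \<and> opn T"
    then obtain h where h: "h \<in> Sec V" "z \<in> nonvanishing X V h" "nonvanishing X V h \<subseteq> T"
      using affine_basis[OF V(1) _ _ z(1)] by blast
    then have "\<not> 0 < w (value_at X y V h)" using van nonvanishing_iff[OF oV] by blast
    then have "value_at X y V h \<noteq> \<zero>\<^bsub>residue_field X y\<^esub>" using val_eq_PInf_iff[of "\<zero>\<^bsub>residue_field X y\<^esub>"] by auto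
    then show "\<exists>x. x \<in> {y} \<and> x \<in> T" using nonvanishing_iff[OF oV h(1)] yV h by blast
  qed
  have "0 \<le> w (value_at X y U s) \<and>
     (0 < w (value_at X y U s) \<longleftrightarrow> value_at X z U s = \<zero>\<^bsub>residue_field X z\<^esub>)"
    if U: "opn U" "z \<in> U" "s \<in> Sec U" for U s
  proof -
    obtain h a n where h: "h \<in> Sec V" "a \<in> Sec V" "z \<in> nonvanishing X V h" "nonvanishing X V h \<subseteq> U"
      and eq: "\<And>x'. x' \<in> nonvanishing X V h \<Longrightarrow>
         germ X x' V h [^]\<^bsub>stalk X x'\<^esub> (n::nat) \<otimes>\<^bsub>stalk X x'\<^esub> germ X x' U s = germ X x' V a"
      by (rule affine_fraction[OF V(1) U(1,2) z(1) U(3)]) blast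
    have yD: "y \<in> nonvanishing X V h"
      by (rule closure_pt_opn[OF zcl affine_nonvanishing_opn[OF V(1) h(1)] h(3)])
    then have yU: "y \<in> U" using h by blast
    note vz = value_of_germ_eq[OF oV U(1,2) z(1) h(1) U(3) h(2) eq[OF h(3)]]
    note vy = value_of_germ_eq[OF oV U(1) yU yV h(1) U(3) h(2) eq[OF yD]]
    have c: "value_at X y V h \<in> carrier (residue_field X y)" "value_at X y U s \<in> carrier (residue_field X y)"
      using value_closed oV U(1) yV yU h(1) U(3) by auto
    \<comment> \<open>The denominator does not vanish at \<open>z\<close>, so its valuation is 0,
      and \<open>s\<close> has the same valuation as the numerator \<open>a\<close>.\<close>
    have "\<not> 0 < w (value_at X y V h)" using van h(1,3) nonvanishing_iff[OF oV] by blast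
    then have "w (value_at X y V h) = 0" using nnV[OF h(1)] by simp
    then have ws: "w (value_at X y V a) = w (value_at X y U s)"
      using val_mult[OF nat_pow_closed[OF c(1)] c(2)] val_pow_zero[OF c(1)] vy by (metis add_0)
    interpret z: field "residue_field X z" by (rule residue_field_field[OF opn_points[OF oV z(1)]])
    have "value_at X z V a = \<zero>\<^bsub>residue_field X z\<^esub> \<longleftrightarrow> value_at X z U s = \<zero>\<^bsub>residue_field X z\<^esub>"
      using z.pow_mult_zero_iff[OF value_closed[OF oV z(1) h(1)] value_closed[OF U], of n]
        h(3) nonvanishing_iff[OF oV h(1)] vz by simp
    then show ?thesis using ws van[OF h(2)] nnV[OF h(2)] by simp
  qed
  then have "dominates w y z" using zcl unfolding dominates_def by blast
  then show ?thesis by (rule that)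
qed

end

section \<open>Uniqueness of the center by separatedness\<close>

locale integral_separated_scheme = integral_local_scheme X for X :: "('a, 'r) ringed_space" +
  assumes separated: "separated_scheme X"
begin

text \<open>The uniqueness half of the valuative criterion. Charts around \<open>z1\<close> and
  \<open>z2\<close> meet in an affine open set whose ring is generated by restrictions from both
  charts. So \<open>w\<close> is nonnegative on it and has a center \<open>z\<close> in the
  intersection. On each chart \<open>z\<close> annihilates the same sections as \<open>z1\<close> or
  \<open>z2\<close> respectively, so both equal \<open>z\<close>.\<close>

lemma dominates_unique:
  assumes val: "valuation (residue_field X y) w" and y: "y \<in> points X"
    and z1: "dominates w y z1" and z2: "dominates w y z2"
  shows "z1 = z2"
proof -
  interpret field_valuation "residue_field X y" w
    by (intro field_valuation.intro residue_field_field y) (unfold_locales, rule val)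
  have cl: "z1 \<in> closure_pt X y" "z2 \<in> closure_pt X y" using z1 z2 by (auto simp: dominates_def)
  then have p: "z1 \<in> points X" "z2 \<in> points X" by (auto simp: in_closure_of)
  obtain V1 where V1: "affine_open X V1" "z1 \<in> V1" using p(1) by (rule affine_nbhd)
  obtain V2 where V2: "affine_open X V2" "z2 \<in> V2" using p(2) by (rule affine_nbhd)
  let ?V = "V1 \<inter> V2"
  note o1 = affine_opn[OF V1(1)] and o2 = affine_opn[OF V2(1)]
  have V: "affine_open X ?V" and gen: "generate_ring (sections X ?V)
          (res X V1 ?V ` Sec V1 \<union> res X V2 ?V ` Sec V2) = Sec ?V"
    using separated V1(1) V2(1) unfolding separated_scheme_def by blast+
  note oV = affine_opn[OF V]
  have yV: "y \<in> V1" "y \<in> V2" "y \<in> ?V" using closure_pt_opn[OF cl(1) o1 V1(2)] closure_pt_opn[OF cl(2) o2 V2(2)] by auto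
  let ?H = "res X V1 ?V ` Sec V1 \<union> res X V2 ?V ` Sec V2"
  have H: "?H \<subseteq> Sec ?V" using res_closed[OF o1 oV] res_closed[OF o2 oV] by auto
  have dom1: "0 \<le> w (value_at X y V1 s) \<and> (0 < w (value_at X y V1 s) \<longleftrightarrow> value_at X z1 V1 s = \<zero>\<^bsub>residue_field X z1\<^esub>)"
    if "s \<in> Sec V1" for s using z1 that o1 V1(2) by (simp add: dominates_def)
  have dom2: "0 \<le> w (value_at X y V2 s) \<and> (0 < w (value_at X y V2 s) \<longleftrightarrow> value_at X z2 V2 s = \<zero>\<^bsub>residue_field X z2\<^esub>)"
    if "s \<in> Sec V2" for s using z2 that o2 V2(2) by (simp add: dominates_def)
  have r1: "value_at X x ?V (res X V1 ?V s) = value_at X x V1 s" if "s \<in> Sec V1" "x \<in> ?V" for s x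
    using value_res[OF o1 oV _ that(2,1)] by simp
  have r2: "value_at X x ?V (res X V2 ?V s) = value_at X x V2 s" if "s \<in> Sec V2" "x \<in> ?V" for s x
    using value_res[OF o2 oV _ that(2,1)] by simp
  have nn: "0 \<le> w (value_at X y ?V s)" if "s \<in> Sec ?V" for s
  proof (rule nonneg_generate_ring[OF sections_cring[OF oV] value_hom[OF oV yV(3)] H])
    show "s \<in> generate_ring (sections X ?V) ?H" using gen that by simp
    show "0 \<le> w (value_at X y ?V s)" if "s \<in> ?H" for s
      using that r1[OF _ yV(3)] r2[OF _ yV(3)] dom1 dom2 by auto
  qed
  let ?Q = "{s \<in> Sec ?V. 0 < w (value_at X y ?V s)}"
  have "primeideal ?Q (sections X ?V)"
    by (rule primeideal_positive[OF sections_cring[OF oV] value_hom[OF oV yV(3)] nn])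
  then obtain z where z: "z \<in> ?V" "vanishing_ideal ?V z = ?Q"
    using prime_imp_point[OF V] by blast
  have van: "value_at X z ?V s = \<zero>\<^bsub>residue_field X z\<^esub> \<longleftrightarrow> 0 < w (value_at X y ?V s)" if "s \<in> Sec ?V" for s
    using vanishing_ideal_iff[OF oV z(1) that] z(2) that by simp
  have "z1 = z"
  proof (rule affine_point_eqI[OF V1])
    show "z \<in> V1" using z by simp
    show "value_at X z1 V1 s = \<zero>\<^bsub>residue_field X z1\<^esub> \<longleftrightarrow> value_at X z V1 s = \<zero>\<^bsub>residue_field X z\<^esub>"
      if s: "s \<in> Sec V1" for s
      using dom1[OF s] van[OF res_closed[OF o1 oV _ s]] r1[OF s z(1)] r1[OF s yV(3)] by simp
  qed
  moreover have "z2 = z"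
  proof (rule affine_point_eqI[OF V2])
    show "z \<in> V2" using z by simp
    show "value_at X z2 V2 s = \<zero>\<^bsub>residue_field X z2\<^esub> \<longleftrightarrow> value_at X z V2 s = \<zero>\<^bsub>residue_field X z\<^esub>"
      if s: "s \<in> Sec V2" for s
      using dom2[OF s] van[OF res_closed[OF o2 oV _ s]] r2[OF s z(1)] r2[OF s yV(3)] by simp
  qed
  ultimately show ?thesis by simp
qed

text \<open>Existence and uniqueness together justify the definite description in
  \<open>center\<close>.\<close>

lemma dominates_center:
  assumes "(w, y) \<in> beth X"
  shows "dominates w y (center X (w, y))"
proof -
  have y: "y \<in> points X" and val: "valuation (residue_field X y) w"
    and nn: "\<exists>z \<in> closure_pt X y. \<forall>a \<in> local_ring_closure X y z. 0 \<le> w a"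
    using assms by (auto simp: beth_def)
  from nn obtain z0 where z0: "z0 \<in> closure_pt X y" "\<forall>a \<in> local_ring_closure X y z0. 0 \<le> w a" by blast
  obtain z where "dominates w y z"
    using dominates_exists[OF val y z0(1)] z0(2) by blast
  then have "\<exists>!z. dominates w y z"
    using dominates_unique[OF val y] by blast
  from theI'[OF this] show ?thesis
    unfolding center_def dominates_iff by simp
qed

end

section \<open>Cartier algebras and evaluation at points\<close>

context integral_local_scheme begin

lemma generic_point_points: "generic_point X \<in> points X"
  using theI'[OF generic_point_ex1] unfolding generic_point_def by blast

lemma function_field_cring: "cring (function_field X)"
  unfolding function_field_def by (rule stalk_cring[OF generic_point_points])

lemma function_field_ring: "ring (function_field X)"
  by (rule cring.axioms(1)[OF function_field_cring])

lemma to_function_field_hom: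
  assumes "opn U" "U \<noteq> {}"
  shows "to_function_field X U \<in> ring_hom (sections X U) (function_field X)"
proof -
  have "to_function_field X U = germ X (generic_point X) U"
    by (auto simp: to_function_field_def)
  then show ?thesis
    unfolding function_field_def using germ_hom[OF assms(1) generic_point_in[OF assms]] by simp
qed

lemma to_function_field_res:
  assumes "opn U" "opn V" "V \<subseteq> U" "V \<noteq> {}" "s \<in> Sec U"
  shows "to_function_field X V (res X U V s) = to_function_field X U s"
  unfolding to_function_field_def using germ_res assms generic_point_in by simp

text \<open>The stalk at \<open>y\<close> as a subset of the function field, the form in which
  Cartier maps can be applied to it.\<close>

definition local_ring :: "'a \<Rightarrow> ('a, 'r) germ set" where
  "local_ring y = {to_function_field X U s | U s. opn U \<and> y \<in> U \<and> s \<in> Sec U}"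

text \<open>The choice of \<open>\<beta>\<close> is unambiguous because stalks embed in the function field
  (\<open>germ_eq_everywhere\<close>).\<close>

definition eval :: "'a \<Rightarrow> ('a, 'r) germ \<Rightarrow> ('a, 'r) germ set" where
  "eval y a = (SOME \<beta>. \<exists>U s. opn U \<and> y \<in> U \<and> s \<in> Sec U \<and> a = to_function_field X U s \<and> \<beta> = value_at X y U s)"

lemma eval_to_function_field:
  assumes U: "opn U" "y \<in> U" "s \<in> Sec U"
  shows "eval y (to_function_field X U s) = value_at X y U s"
proof -
  let ?P = "\<lambda>\<beta>. \<exists>V t. opn V \<and> y \<in> V \<and> t \<in> Sec V \<and>
     to_function_field X U s = to_function_field X V t \<and> \<beta> = value_at X y V t"
  have "?P (value_at X y U s)" using U by blast
  then have "?P (eval y (to_function_field X U s))"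
    unfolding eval_def by (rule someI)
  then obtain V t where V: "opn V" "y \<in> V" "t \<in> Sec V"
     "to_function_field X U s = to_function_field X V t" "eval y (to_function_field X U s) = value_at X y V t"
    by blast
  have g: "generic_point X \<in> U" "generic_point X \<in> V" using generic_point_in U V by blast+
  have "germ X y U s = germ X y V t"
    by (rule germ_eq_everywhere[OF U(1,3) V(1,3) g _ U(2) V(2)]) (use V(4) in \<open>simp add: to_function_field_def\<close>)
  then show ?thesis using V(5) by (simp add: value_at_def)
qed

lemma local_ringI: "opn U \<Longrightarrow> y \<in> U \<Longrightarrow> s \<in> Sec U \<Longrightarrow> to_function_field X U s \<in> local_ring y"
  unfolding local_ring_def by blast

lemma local_ringE:
  assumes "a \<in> local_ring y"
  obtains U s where "opn U" "y \<in> U" "s \<in> Sec U" "a = to_function_field X U s"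
  using assms unfolding local_ring_def by blast

lemma local_ring_closed: "a \<in> local_ring y \<Longrightarrow> a \<in> carrier (function_field X)"
  by (erule local_ringE) (use ring_hom_closed[OF to_function_field_hom] in blast)

lemma eval_closed: "a \<in> local_ring y \<Longrightarrow> eval y a \<in> carrier (residue_field X y)"
  by (erule local_ringE) (simp add: eval_to_function_field value_closed)

lemma local_ring_common:
  assumes "a \<in> local_ring y" "b \<in> local_ring y"
  obtains U s t where "opn U" "y \<in> U" "s \<in> Sec U" "t \<in> Sec U"
    "a = to_function_field X U s" "b = to_function_field X U t"
proof -
  obtain U s where U: "opn U" "y \<in> U" "s \<in> Sec U" "a = to_function_field X U s"
    using assms(1) by (rule local_ringE)
  obtain V t where V: "opn V" "y \<in> V" "t \<in> Sec V" "b = to_function_field X V t"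
    using assms(2) by (rule local_ringE)
  have W: "opn (U \<inter> V)" "y \<in> U \<inter> V" "U \<inter> V \<noteq> {}" using U V by auto
  show ?thesis
    using to_function_field_res[OF U(1) W(1) _ W(3) U(3)] to_function_field_res[OF V(1) W(1) _ W(3) V(3)]
      res_closed[OF U(1) W(1) _ U(3)] res_closed[OF V(1) W(1) _ V(3)] U(4) V(4)
    by (intro that[OF W(1,2), of "res X U (U \<inter> V) s" "res X V (U \<inter> V) t"]) auto
qed

lemma
  assumes "a \<in> local_ring y" "b \<in> local_ring y"
  shows local_ring_add: "a \<oplus>\<^bsub>function_field X\<^esub> b \<in> local_ring y"
    and eval_add: "eval y (a \<oplus>\<^bsub>function_field X\<^esub> b) = eval y a \<oplus>\<^bsub>residue_field X y\<^esub> eval y b"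
    and local_ring_mult: "a \<otimes>\<^bsub>function_field X\<^esub> b \<in> local_ring y"
    and eval_mult: "eval y (a \<otimes>\<^bsub>function_field X\<^esub> b) = eval y a \<otimes>\<^bsub>residue_field X y\<^esub> eval y b"
    and local_ring_minus: "a \<ominus>\<^bsub>function_field X\<^esub> b \<in> local_ring y"
    and eval_minus: "eval y (a \<ominus>\<^bsub>function_field X\<^esub> b) = eval y a \<ominus>\<^bsub>residue_field X y\<^esub> eval y b"
proof -
  obtain U s t where U: "opn U" "y \<in> U" and s: "s \<in> Sec U" and t: "t \<in> Sec U"
    and a: "a = to_function_field X U s" and b: "b = to_function_field X U t"
    using local_ring_common[OF assms] .
  have ne: "U \<noteq> {}" using U by blast
  note f = to_function_field_hom[OF U(1) ne] and v = value_hom[OF U]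
  note r = sections_ring[OF U(1)] residue_field_ring[OF opn_points[OF U]]
  have m: "s \<ominus>\<^bsub>sections X U\<^esub> t \<in> Sec U" by (rule ring.ring_simprules(4)[OF r(1) s t])
  have eqs: "a \<oplus>\<^bsub>function_field X\<^esub> b = to_function_field X U (s \<oplus>\<^bsub>sections X U\<^esub> t)"
    "a \<otimes>\<^bsub>function_field X\<^esub> b = to_function_field X U (s \<otimes>\<^bsub>sections X U\<^esub> t)"
    "a \<ominus>\<^bsub>function_field X\<^esub> b = to_function_field X U (s \<ominus>\<^bsub>sections X U\<^esub> t)"
    unfolding a b using ring_hom_add[OF f s t] ring_hom_mult[OF f s t]
      ring_hom_minus[OF r(1) function_field_ring f s t] by simp_all
  show "a \<oplus>\<^bsub>function_field X\<^esub> b \<in> local_ring y" "a \<otimes>\<^bsub>function_field X\<^esub> b \<in> local_ring y"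
    "a \<ominus>\<^bsub>function_field X\<^esub> b \<in> local_ring y"
    unfolding eqs by (rule local_ringI[OF U], rule add_closed[OF U(1) s t] mult_closed[OF U(1) s t] m)+
  show "eval y (a \<oplus>\<^bsub>function_field X\<^esub> b) = eval y a \<oplus>\<^bsub>residue_field X y\<^esub> eval y b"
    unfolding eqs unfolding a b eval_to_function_field[OF U add_closed[OF U(1) s t]]
      eval_to_function_field[OF U s] eval_to_function_field[OF U t] by (rule ring_hom_add[OF v s t])
  show "eval y (a \<otimes>\<^bsub>function_field X\<^esub> b) = eval y a \<otimes>\<^bsub>residue_field X y\<^esub> eval y b"
    unfolding eqs unfolding a b eval_to_function_field[OF U mult_closed[OF U(1) s t]]
      eval_to_function_field[OF U s] eval_to_function_field[OF U t] by (rule ring_hom_mult[OF v s t])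
  show "eval y (a \<ominus>\<^bsub>function_field X\<^esub> b) = eval y a \<ominus>\<^bsub>residue_field X y\<^esub> eval y b"
    unfolding eqs unfolding a b eval_to_function_field[OF U m]
      eval_to_function_field[OF U s] eval_to_function_field[OF U t] by (rule ring_hom_minus[OF r v s t])
qed

lemma
  assumes a: "a \<in> local_ring y"
  shows local_ring_pow: "a [^]\<^bsub>function_field X\<^esub> (n::nat) \<in> local_ring y"
    and eval_pow: "eval y (a [^]\<^bsub>function_field X\<^esub> n) = eval y a [^]\<^bsub>residue_field X y\<^esub> n"
proof -
  obtain U s where U: "opn U" "y \<in> U" "s \<in> Sec U" and a: "a = to_function_field X U s"
    using a by (rule local_ringE)
  have ne: "U \<noteq> {}" using U by blast
  have eq: "a [^]\<^bsub>function_field X\<^esub> n = to_function_field X U (s [^]\<^bsub>sections X U\<^esub> n)"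
    unfolding a by (rule ring_hom_nat_pow[OF sections_ring[OF U(1)] function_field_ring
      to_function_field_hom[OF U(1) ne] U(3), symmetric])
  show "a [^]\<^bsub>function_field X\<^esub> n \<in> local_ring y"
    unfolding eq by (rule local_ringI[OF U(1,2) pow_closed[OF U(1,3)]])
  show "eval y (a [^]\<^bsub>function_field X\<^esub> n) = eval y a [^]\<^bsub>residue_field X y\<^esub> n"
    unfolding eq eval_to_function_field[OF U(1,2) pow_closed[OF U(1,3)]] unfolding a
      eval_to_function_field[OF U] by (rule value_pow[OF U])
qed

lemma eval_surj:
  assumes "\<alpha> \<in> carrier (residue_field X y)"
  obtains a where "a \<in> local_ring y" "\<alpha> = eval y a"
proof -
  obtain U s where U: "opn U" "y \<in> U" "s \<in> Sec U" "\<alpha> = value_at X y U s"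
    using assms by (rule value_surj)
  show ?thesis
    using that[OF local_ringI[OF U(1-3)]] eval_to_function_field[OF U(1-3)] U(4) by simp
qed

lemma local_ring_specialization: "z \<in> closure_pt X y \<Longrightarrow> a \<in> local_ring z \<Longrightarrow> a \<in> local_ring y"
  by (erule local_ringE) (use local_ringI closure_pt_opn in blast)

text \<open>The factor is a \<open>q\<close>-th power because for q = p^e a p^-e-linear map pulls it
  out as a single factor \<open>B\<close>. If a = f / h^n on the chart, then B = h^n works.\<close>

lemma clear_denominator:
  assumes V: "affine_open X V" "y \<in> V" and a: "a \<in> local_ring y" and q: "q \<noteq> (0::nat)"
  obtains F B where "F \<in> Sec V" "B \<in> Sec V" "value_at X y V B \<noteq> \<zero>\<^bsub>residue_field X y\<^esub>"
    "to_function_field X V F = to_function_field X V B [^]\<^bsub>function_field X\<^esub> q \<otimes>\<^bsub>function_field X\<^esub> a"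
proof -
  note oV = affine_opn[OF V(1)]
  obtain U s where U: "opn U" "y \<in> U" "s \<in> Sec U" and a_eq: "a = to_function_field X U s"
    using a by (rule local_ringE)
  obtain h f n where h: "h \<in> Sec V" "f \<in> Sec V" "y \<in> nonvanishing X V h" "nonvanishing X V h \<subseteq> U"
    and eq: "\<And>x'. x' \<in> nonvanishing X V h \<Longrightarrow>
       germ X x' V h [^]\<^bsub>stalk X x'\<^esub> (n::nat) \<otimes>\<^bsub>stalk X x'\<^esub> germ X x' U s = germ X x' V f"
    by (rule affine_fraction[OF V(1) U(1,2) V(2) U(3)]) blast
  define B where "B = h [^]\<^bsub>sections X V\<^esub> n"
  have B: "B \<in> Sec V" unfolding B_def by (rule pow_closed[OF oV h(1)])
  have ne: "V \<noteq> {}" "nonvanishing X V h \<noteq> {}" using V h by auto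
  note hom = to_function_field_hom[OF oV ne(1)]
  let ?B = "to_function_field X V B"
  interpret L: cring "function_field X" by (rule function_field_cring)
  have "generic_point X \<in> nonvanishing X V h"
    by (rule generic_point_in[OF affine_nonvanishing_opn[OF V(1) h(1)] ne(2)])
  from eq[OF this] have Ba: "?B \<otimes>\<^bsub>function_field X\<^esub> a = to_function_field X V f"
    unfolding B_def a_eq ring_hom_nat_pow[OF sections_ring[OF oV] function_field_ring hom h(1)]
    by (simp add: to_function_field_def function_field_def)
  have c: "?B \<in> carrier (function_field X)" "a \<in> carrier (function_field X)"
    using ring_hom_closed[OF hom B] local_ring_closed[OF a] by auto
  \<comment> \<open>One factor \<open>B\<close> clears the denominator of \<open>a\<close>; the
    remaining q - 1 stay in front of the numerator.\<close>
  obtain m where m: "q = Suc m" using q by (cases q) auto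
  interpret k: field "residue_field X y" by (rule residue_field_field[OF opn_points[OF oV V(2)]])
  show ?thesis
  proof (rule that)
    show "B [^]\<^bsub>sections X V\<^esub> m \<otimes>\<^bsub>sections X V\<^esub> f \<in> Sec V"
      by (intro mult_closed[OF oV] pow_closed[OF oV] B h)
    show "value_at X y V B \<noteq> \<zero>\<^bsub>residue_field X y\<^esub>"
      unfolding B_def value_pow[OF oV V(2) h(1)]
      using k.nat_pow_nonzero[OF value_closed[OF oV V(2) h(1)]] h(3) nonvanishing_iff[OF oV h(1)] by blast
    show "to_function_field X V (B [^]\<^bsub>sections X V\<^esub> m \<otimes>\<^bsub>sections X V\<^esub> f) =
        ?B [^]\<^bsub>function_field X\<^esub> q \<otimes>\<^bsub>function_field X\<^esub> a"
      unfolding ring_hom_mult[OF hom pow_closed[OF oV B] h(2)]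
        ring_hom_nat_pow[OF sections_ring[OF oV] function_field_ring hom B] Ba[symmetric] m
      using c by (simp add: L.m_assoc)
  qed (rule B)
qed

end

section \<open>Cartier maps on local rings and on residue fields\<close>

locale cartier_scheme = integral_separated_scheme X for X :: "('a, 'r) ringed_space" +
  fixes p :: nat and D :: "nat \<Rightarrow> 'a set \<Rightarrow> (('a, 'r) germ \<Rightarrow> ('a, 'r) germ) set"
  assumes char: "has_prime_char X p" and cartier: "cartier_subalgebra X p D"
begin

lemma p_ge_2: "2 \<le> p"
  using char prime_ge_2_nat unfolding has_prime_char_def by blast

lemma D_cartier_maps: "\<psi> \<in> D e U \<Longrightarrow> opn U \<Longrightarrow> U \<noteq> {} \<Longrightarrow> \<psi> \<in> cartier_maps X p e U"
  using cartier[unfolded cartier_subalgebra_def Let_def, THEN conjunct1] by blast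

lemma D_mono: "\<psi> \<in> D e U \<Longrightarrow> opn U \<Longrightarrow> opn V \<Longrightarrow> V \<noteq> {} \<Longrightarrow> V \<subseteq> U \<Longrightarrow> \<psi> \<in> D e V"
  using cartier[unfolded cartier_subalgebra_def Let_def, THEN conjunct2, THEN conjunct1] by blast

lemma D_compose:
  "\<psi> \<in> D d U \<Longrightarrow> \<phi> \<in> D e U \<Longrightarrow> opn U \<Longrightarrow> U \<noteq> {} \<Longrightarrow>
    compose (carrier (function_field X)) \<psi> \<phi> \<in> D (d + e) U"
  using cartier[unfolded cartier_subalgebra_def Let_def, THEN conjunct2, THEN conjunct2, THEN conjunct2, THEN conjunct2, THEN conjunct1] by blast

lemma D_quasi_coherent:
  assumes "affine_open X U" "h \<in> Sec U" "nonvanishing X U h \<noteq> {}" "\<psi> \<in> D e (nonvanishing X U h)"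
  obtains n :: nat where
    "scalar_map (function_field X) (to_function_field X U h [^]\<^bsub>function_field X\<^esub> n) \<psi> \<in> D e U"
  using cartier[unfolded cartier_subalgebra_def Let_def, THEN conjunct2, THEN conjunct2, THEN conjunct2, THEN conjunct2, THEN conjunct2, THEN conjunct2] assms by blast

lemma D_p_inv_linear: "\<psi> \<in> D e U \<Longrightarrow> opn U \<Longrightarrow> U \<noteq> {} \<Longrightarrow> p_inv_linear (function_field X) p e \<psi>"
  using D_cartier_maps unfolding cartier_maps_def by blast

lemma D_sections:
  assumes "\<psi> \<in> D e U" "opn U" "opn W" "W \<noteq> {}" "W \<subseteq> U" "s \<in> Sec W"
  obtains t where "t \<in> Sec W" "\<psi> (to_function_field X W s) = to_function_field X W t"
proof -
  have "\<psi> \<in> cartier_maps X p e U" by (rule D_cartier_maps) (use assms in auto)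
  then have "\<psi> ` to_function_field X W ` Sec W \<subseteq> to_function_field X W ` Sec W"
    using assms(3-5) unfolding cartier_maps_def by blast
  then show ?thesis using assms(6) that by blast
qed

lemma D_local_ring:
  assumes \<psi>: "\<psi> \<in> D e U" "opn U" "y \<in> U" and a: "a \<in> local_ring y"
  shows "\<psi> a \<in> local_ring y"
proof -
  obtain V s where V: "opn V" "y \<in> V" "s \<in> Sec V" and a: "a = to_function_field X V s"
    using a by (rule local_ringE)
  have W: "opn (U \<inter> V)" "y \<in> U \<inter> V" "U \<inter> V \<noteq> {}" using \<psi> V by auto
  have s: "res X V (U \<inter> V) s \<in> Sec (U \<inter> V)" using res_closed[OF V(1) W(1) _ V(3)] by blast
  obtain t where t: "t \<in> Sec (U \<inter> V)"
      "\<psi> (to_function_field X (U \<inter> V) (res X V (U \<inter> V) s)) = to_function_field X (U \<inter> V) t"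
    by (rule D_sections[OF \<psi>(1,2) W(1,3) _ s]) auto
  then have "\<psi> a = to_function_field X (U \<inter> V) t"
    unfolding a using to_function_field_res[OF V(1) W(1) _ W(3) V(3)] by simp
  then show ?thesis using local_ringI[OF W(1,2) t(1)] by simp
qed

text \<open>As \<open>y\<close> is generic in its closure, an element of its local ring with value
  zero vanishes at all nearby points of the closure, so it lies in the ideal stalk at
  \<open>y\<close>. Compatibility at the single point \<open>y\<close> then suffices.\<close>

lemma compatible_eval_zero:
  assumes comp: "uniformly_compatible X D (closure_pt X y)"
    and \<psi>: "\<psi> \<in> D e U" "opn U" "y \<in> U" "1 \<le> e" and a: "a \<in> local_ring y" "eval y a = \<zero>\<^bsub>residue_field X y\<^esub>"
  shows "eval y (\<psi> a) = \<zero>\<^bsub>residue_field X y\<^esub>"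
proof -
  obtain V s where V: "opn V" "y \<in> V" "s \<in> Sec V" and a_eq: "a = to_function_field X V s"
    using a(1) by (rule local_ringE)
  have y: "y \<in> points X" by (rule opn_points[OF V(1,2)])
  have v: "value_at X y V s = \<zero>\<^bsub>residue_field X y\<^esub>"
    using a(2) unfolding a_eq eval_to_function_field[OF V] .
  have "germ X z V s \<in> max_ideal_at X z" if "z \<in> closure_pt X y \<inter> V" for z
    using value_zero_specialization[OF _ V(1) _ V(3) v] value_zero_iff[OF V(1) _ V(3)] that by blast
  then have "a \<in> ideal_stalk X (closure_pt X y) y"
    unfolding ideal_stalk_def a_eq using V by blast
  moreover have "\<psi> \<in> cartier_stalk X D e y" unfolding cartier_stalk_def using \<psi> by blast
  ultimately have "\<psi> a \<in> ideal_stalk X (closure_pt X y) y"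
    using comp y \<psi>(4) unfolding uniformly_compatible_def by blast
  then obtain W t where W: "opn W" "y \<in> W" "t \<in> Sec W" "\<psi> a = to_function_field X W t"
      "\<forall>z \<in> closure_pt X y \<inter> W. germ X z W t \<in> max_ideal_at X z"
    unfolding ideal_stalk_def by blast
  have "y \<in> closure_pt X y" using y by (simp add: in_closure_of)
  then show ?thesis
    unfolding W(4) eval_to_function_field[OF W(1-3)] value_zero_iff[OF W(1-3)] using W by blast
qed

text \<open>Compatibility may fail at an arbitrary point \<open>x\<close>, and the failure is moved
  to \<open>y\<close>. The image of \<open>a\<close> is a section near \<open>x\<close> that is
  nonzero at some \<open>z\<close> in the closure of \<open>y\<close>; nonvanishing passes to the
  generization \<open>y\<close>.\<close>

lemma incompatible_witness:
  assumes y: "y \<in> points X" and ncomp: "\<not> uniformly_compatible X D (closure_pt X y)"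
  obtains e U \<psi> a where "1 \<le> e" "opn U" "y \<in> U" "\<psi> \<in> D e U" "a \<in> local_ring y"
    "eval y a = \<zero>\<^bsub>residue_field X y\<^esub>" "eval y (\<psi> a) \<noteq> \<zero>\<^bsub>residue_field X y\<^esub>"
proof -
  obtain x e \<psi> a where x: "x \<in> points X" and e: "1 \<le> e" and \<psi>: "\<psi> \<in> cartier_stalk X D e x"
    and a: "a \<in> ideal_stalk X (closure_pt X y) x" "\<psi> a \<notin> ideal_stalk X (closure_pt X y) x"
    using ncomp unfolding uniformly_compatible_def by blast
  obtain U where U: "opn U" "x \<in> U" "\<psi> \<in> D e U"
    using \<psi> unfolding cartier_stalk_def by blast
  obtain V s where V: "opn V" "x \<in> V" "s \<in> Sec V" and a_eq: "a = to_function_field X V s"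
    and van: "\<forall>z \<in> closure_pt X y \<inter> V. germ X z V s \<in> max_ideal_at X z"
    using a(1) unfolding ideal_stalk_def by blast
  let ?W = "U \<inter> V"
  have W: "opn ?W" "x \<in> ?W" "?W \<noteq> {}" using U V by auto
  have s: "res X V ?W s \<in> Sec ?W" using res_closed[OF V(1) W(1) _ V(3)] by blast
  obtain t where t: "t \<in> Sec ?W" "\<psi> (to_function_field X ?W (res X V ?W s)) = to_function_field X ?W t"
    by (rule D_sections[OF U(3,1) W(1,3) _ s]) auto
  then have \<psi>a: "\<psi> a = to_function_field X ?W t"
    unfolding a_eq using to_function_field_res[OF V(1) W(1) _ W(3) V(3)] by simp
  \<comment> \<open>Without such a point, \<open>t\<close> would exhibit the image of
    \<open>a\<close> as an element of the ideal stalk at \<open>x\<close>.\<close>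
  obtain z where z: "z \<in> closure_pt X y" "z \<in> ?W" "germ X z ?W t \<notin> max_ideal_at X z"
    using a(2) W t(1) unfolding \<psi>a ideal_stalk_def by blast
  have yW: "y \<in> ?W" by (rule closure_pt_opn[OF z(1) W(1) z(2)])
  have ycl: "y \<in> closure_pt X y" using y by (simp add: in_closure_of)
  show ?thesis
  proof (rule that[OF e U(1) _ U(3)])
    show "y \<in> U" using yW by blast
    show "a \<in> local_ring y" unfolding a_eq using local_ringI[OF V(1) _ V(3)] yW by blast
    show "eval y a = \<zero>\<^bsub>residue_field X y\<^esub>"
      unfolding a_eq using eval_to_function_field[OF V(1) _ V(3)] value_zero_iff[OF V(1) _ V(3)] yW van ycl by auto
    show "eval y (\<psi> a) \<noteq> \<zero>\<^bsub>residue_field X y\<^esub>"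
      unfolding \<psi>a eval_to_function_field[OF W(1) yW t(1)]
      using value_zero_specialization[OF z(1) W(1) z(2) t(1)] value_zero_iff[OF W(1) z(2) t(1)] z(3) by blast
  qed
qed

text \<open>By compatibility \<psi> preserves the kernel of evaluation at \<open>y\<close>, so it
  descends from the local ring to the residue field.\<close>

lemma induced_map_exists:
  assumes comp: "uniformly_compatible X D (closure_pt X y)"
    and \<psi>: "\<psi> \<in> D e U" "opn U" "y \<in> U" "1 \<le> e"
  obtains \<phi> where "p_inv_linear (residue_field X y) p e \<phi>"
    "\<And>a. a \<in> local_ring y \<Longrightarrow> \<phi> (eval y a) = eval y (\<psi> a)"
proof -
  have U: "U \<noteq> {}" using \<psi> by blast
  have y: "y \<in> points X" by (rule opn_points[OF \<psi>(2,3)])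
  let ?K = "residue_field X y" and ?L = "function_field X"
  interpret K: field ?K by (rule residue_field_field[OF y])
  interpret L: cring ?L by (rule function_field_cring)
  note lin = D_p_inv_linear[OF \<psi>(1,2) U]
  have add: "\<psi> (a \<oplus>\<^bsub>?L\<^esub> b) = \<psi> a \<oplus>\<^bsub>?L\<^esub> \<psi> b" if "a \<in> local_ring y" "b \<in> local_ring y" for a b
    using lin that[THEN local_ring_closed] unfolding p_inv_linear_def by blast
  have mult: "\<psi> (a [^]\<^bsub>?L\<^esub> (p ^ e) \<otimes>\<^bsub>?L\<^esub> b) = a \<otimes>\<^bsub>?L\<^esub> \<psi> b" if "a \<in> local_ring y" "b \<in> local_ring y" for a b
    using lin that[THEN local_ring_closed] unfolding p_inv_linear_def by blast
  note loc = D_local_ring[OF \<psi>(1-3)]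
  have wd: "eval y (\<psi> a) = eval y (\<psi> b)" if ab: "a \<in> local_ring y" "b \<in> local_ring y" "eval y a = eval y b" for a b
  proof -
    let ?d = "a \<ominus>\<^bsub>?L\<^esub> b"
    have d: "?d \<in> local_ring y" by (rule local_ring_minus[OF ab(1,2)])
    have "eval y ?d = \<zero>\<^bsub>?K\<^esub>"
      unfolding eval_minus[OF ab(1,2)] using eval_closed ab by simp
    then have z: "eval y (\<psi> ?d) = \<zero>\<^bsub>?K\<^esub>" by (rule compatible_eval_zero[OF comp \<psi> d])
    have "a = ?d \<oplus>\<^bsub>?L\<^esub> b"
      using local_ring_closed[OF ab(1)] local_ring_closed[OF ab(2)] by (simp add: L.minus_eq L.a_assoc L.l_neg)
    then have "eval y (\<psi> a) = eval y (\<psi> ?d) \<oplus>\<^bsub>?K\<^esub> eval y (\<psi> b)"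
      using add[OF d ab(2)] eval_add[OF loc[OF d] loc[OF ab(2)]] by simp
    then show ?thesis using z eval_closed[OF loc[OF ab(2)]] by simp
  qed
  \<comment> \<open>A mere choice of representatives, with no algebraic structure; \<open>wd\<close>
    makes the result independent of it.\<close>
  define lift where "lift \<alpha> = (SOME a. a \<in> local_ring y \<and> eval y a = \<alpha>)" for \<alpha>
  have lift: "lift \<alpha> \<in> local_ring y \<and> eval y (lift \<alpha>) = \<alpha>" if "\<alpha> \<in> carrier ?K" for \<alpha>
    unfolding lift_def by (rule someI_ex) (rule eval_surj[OF that], blast)
  define \<phi> where "\<phi> = (\<lambda>\<alpha> \<in> carrier ?K. eval y (\<psi> (lift \<alpha>)))"
  have \<phi>: "\<phi> (eval y a) = eval y (\<psi> a)" if "a \<in> local_ring y" for a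
    unfolding \<phi>_def using wd[OF _ that] lift[OF eval_closed[OF that]] eval_closed[OF that] by simp
  have "p_inv_linear ?K p e \<phi>"
    unfolding p_inv_linear_def
  proof (intro conjI ballI)
    show "\<phi> \<in> carrier ?K \<rightarrow>\<^sub>E carrier ?K"
      unfolding \<phi>_def using lift loc eval_closed by simp
    fix f g assume "f \<in> carrier ?K" "g \<in> carrier ?K"
    then obtain a b where a: "a \<in> local_ring y" "f = eval y a" and b: "b \<in> local_ring y" "g = eval y b"
      using lift by (metis (no_types))
    show "\<phi> (f \<oplus>\<^bsub>?K\<^esub> g) = \<phi> f \<oplus>\<^bsub>?K\<^esub> \<phi> g"
      unfolding a(2) b(2) eval_add[OF a(1) b(1), symmetric] \<phi>[OF a(1)] \<phi>[OF b(1)]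
        \<phi>[OF local_ring_add[OF a(1) b(1)]] add[OF a(1) b(1)]
      by (rule eval_add[OF loc[OF a(1)] loc[OF b(1)]])
    show "\<phi> (f [^]\<^bsub>?K\<^esub> (p ^ e) \<otimes>\<^bsub>?K\<^esub> g) = f \<otimes>\<^bsub>?K\<^esub> \<phi> g"
      unfolding a(2) b(2) eval_pow[OF a(1), symmetric] eval_mult[OF local_ring_pow[OF a(1)] b(1), symmetric]
        \<phi>[OF b(1)] \<phi>[OF local_ring_mult[OF local_ring_pow[OF a(1)] b(1)]] mult[OF a(1) b(1)]
      by (rule eval_mult[OF a(1) loc[OF b(1)]])
  qed
  then show ?thesis using \<phi> by (rule that)
qed

end

section \<open>Semicontinuity\<close>

lemma E_quot_greater_iff:
  assumes p: "2 \<le> p" and e: "1 \<le> e" and r: "v f = ereal r" "v (\<psi> f) = ereal r'"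
  shows "ereal a < E_quot p e v f \<psi> \<longleftrightarrow> real p ^ e * r' + a * (real p ^ e - 1) < r"
proof -
  have "1 < real p ^ e" using p e by (intro one_less_power) auto
  then show ?thesis
    unfolding E_quot_def r by (simp add: pos_less_divide_eq algebra_simps)
qed

text \<open>Nonzero elements killed by \<psi> remain in the supremum defining the log discrepancy.
  They contribute -\<infinity>, so they never exceed a real bound.\<close>

lemma E_quot_zero:
  assumes p: "2 \<le> p" and e: "1 \<le> e" and r: "v f = ereal r" "v (\<psi> f) = \<infinity>"
  shows "E_quot p e v f \<psi> = -\<infinity>"
proof -
  have "1 < real p ^ e" using p e by (intro one_less_power) auto
  then show ?thesis
    unfolding E_quot_def r using p by simp
qed

lemma p_inv_linear_closed: "p_inv_linear K p e \<phi> \<Longrightarrow> f \<in> carrier K \<Longrightarrow> \<phi> f \<in> carrier K"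
  unfolding p_inv_linear_def by blast

lemma p_inv_linear_mult:
  "p_inv_linear K p e \<phi> \<Longrightarrow> f \<in> carrier K \<Longrightarrow> g \<in> carrier K \<Longrightarrow>
    \<phi> ((f [^]\<^bsub>K\<^esub> (p ^ e)) \<otimes>\<^bsub>K\<^esub> g) = f \<otimes>\<^bsub>K\<^esub> \<phi> g"
  unfolding p_inv_linear_def by blast

lemma p_inv_linear_zero:
  assumes K: "cring K" and \<phi>: "p_inv_linear K p e \<phi>" and p: "p \<noteq> 0"
  shows "\<phi> \<zero>\<^bsub>K\<^esub> = \<zero>\<^bsub>K\<^esub>"
proof -
  interpret cring K by fact
  have "\<phi> (\<zero>\<^bsub>K\<^esub> [^]\<^bsub>K\<^esub> (p ^ e) \<otimes>\<^bsub>K\<^esub> \<zero>\<^bsub>K\<^esub>) = \<zero>\<^bsub>K\<^esub> \<otimes>\<^bsub>K\<^esub> \<phi> \<zero>\<^bsub>K\<^esub>"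
    by (rule p_inv_linear_mult[OF \<phi>]) auto
  then show ?thesis using p_inv_linear_closed[OF \<phi>] by simp
qed

text \<open>Each application of \<phi> extracts one p^e-th root from the factor. The innermost
  application is split off: it leaves the p^(n e)-th power of \<open>f\<close> for the other
  n.\<close>

lemma funpow_p_inv_linear:
  assumes K: "cring K" and \<phi>: "p_inv_linear K p e \<phi>" and f: "f \<in> carrier K"
  shows "g \<in> carrier K \<Longrightarrow> (\<phi> ^^ n) ((f [^]\<^bsub>K\<^esub> (p ^ (n * e))) \<otimes>\<^bsub>K\<^esub> g) = f \<otimes>\<^bsub>K\<^esub> (\<phi> ^^ n) g"
proof (induction n arbitrary: g)
  case 0
  interpret cring K by fact
  show ?case using 0 f by simp
next
  case (Suc n)
  interpret cring K by fact
  have "f [^]\<^bsub>K\<^esub> (p ^ (Suc n * e)) = (f [^]\<^bsub>K\<^esub> (p ^ (n * e))) [^]\<^bsub>K\<^esub> (p ^ e)"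
    using f by (simp add: nat_pow_pow power_add mult.commute)
  then have "\<phi> ((f [^]\<^bsub>K\<^esub> (p ^ (Suc n * e))) \<otimes>\<^bsub>K\<^esub> g) = f [^]\<^bsub>K\<^esub> (p ^ (n * e)) \<otimes>\<^bsub>K\<^esub> \<phi> g"
    using p_inv_linear_mult[OF \<phi> _ Suc.prems, of "f [^]\<^bsub>K\<^esub> (p ^ (n * e))"] f by simp
  then show ?case
    using Suc.IH[OF p_inv_linear_closed[OF \<phi> Suc.prems]] by (simp only: funpow_Suc_right comp_apply)
qed

section \<open>From the log discrepancy to sections over an affine open set, and back\<close>

context cartier_scheme begin

lemma field_valuation_beth:
  assumes "(w, y) \<in> beth X"
  shows "field_valuation (residue_field X y) w"
  using assms residue_field_field[of y]
  by (auto simp: beth_def field_valuation_def field_valuation_axioms_def)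

text \<open>Composition in \<open>D\<close> adds degrees. Agreement is claimed only on the function
  field, since \<open>compose\<close> is extensional and the plain iterate need not be.\<close>

lemma D_funpow:
  assumes \<psi>: "\<psi> \<in> D e U" "opn U" "U \<noteq> {}"
  shows "\<exists>\<psi>' \<in> D (Suc n * e) U. \<forall>c \<in> carrier (function_field X). \<psi>' c = (\<psi> ^^ Suc n) c"
proof (induction n)
  case 0
  show ?case using \<psi> by auto
next
  case (Suc n)
  then obtain \<psi>' where \<psi>': "\<psi>' \<in> D (Suc n * e) U"
      "\<forall>c \<in> carrier (function_field X). \<psi>' c = (\<psi> ^^ Suc n) c" by blast
  have "compose (carrier (function_field X)) \<psi> \<psi>' \<in> D (e + Suc n * e) U"
    by (rule D_compose[OF \<psi>(1) \<psi>'(1) \<psi>(2,3)])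
  then show ?case
    using \<psi>'(2) by (intro bexI[of _ "compose (carrier (function_field X)) \<psi> \<psi>'"]) (auto simp: compose_def)
qed

text \<open>Quasi-coherence for a basic neighbourhood D(h) of \<open>x\<close> inside
  \<open>U\<close>. The extra factor does not vanish at \<open>x\<close>, so it has valuation 0 when
  \<open>x\<close> is the center.\<close>

lemma affine_extension:
  assumes V: "affine_open X V" "x \<in> V" and U: "opn U" "x \<in> U" and \<psi>: "\<psi> \<in> D e U"
  obtains h \<Psi> and n :: nat where "h \<in> Sec V" "x \<in> nonvanishing X V h" "nonvanishing X V h \<subseteq> U" "\<Psi> \<in> D e V"
    "\<And>a. a \<in> carrier (function_field X) \<Longrightarrow>
       \<Psi> a = to_function_field X V h [^]\<^bsub>function_field X\<^esub> n \<otimes>\<^bsub>function_field X\<^esub> \<psi> a"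
proof -
  obtain h where h: "h \<in> Sec V" "x \<in> nonvanishing X V h" "nonvanishing X V h \<subseteq> U"
    using affine_basis[OF V(1) U V(2)] .
  have ne: "nonvanishing X V h \<noteq> {}" using h by blast
  have "\<psi> \<in> D e (nonvanishing X V h)"
    by (rule D_mono[OF \<psi> U(1) affine_nonvanishing_opn[OF V(1) h(1)] ne h(3)])
  then obtain n :: nat where
      "scalar_map (function_field X) (to_function_field X V h [^]\<^bsub>function_field X\<^esub> n) \<psi> \<in> D e V"
    using D_quasi_coherent[OF V(1) h(1) ne] by blast
  from that[OF h this] show ?thesis by (simp add: scalar_map_def)
qed

text \<open>In the compatible case the inequality says E > a for the value of \<open>f\<close> and
  the map induced by \<open>\<Psi>\<close> on the residue field, so the exponent n = 1 already
  bounds the suprema from below. In the other case the log discrepancy is \<infinity>.\<close>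

lemma log_discrepancy_greaterI:
  assumes b: "(w, y) \<in> beth X" and V: "opn V" "center X (w, y) \<in> V"
    and \<Psi>: "\<Psi> \<in> D e V" "1 \<le> e" and f: "f \<in> Sec V" and g: "g \<in> Sec V"
    and eq: "\<Psi> (to_function_field X V f) = to_function_field X V g"
    and fin: "w (value_at X y V g) \<noteq> \<infinity>"
    and gr: "ereal (real p ^ e) * w (value_at X y V g) + ereal (a * (real p ^ e - 1)) < w (value_at X y V f)"
  shows "ereal a < log_discrepancy X p D (w, y)"
proof (cases "uniformly_compatible X D (closure_pt X y)")
  case comp: True
  let ?z = "center X (w, y)" and ?K = "residue_field X y"
  interpret field_valuation ?K w by (rule field_valuation_beth[OF b])
  have zcl: "?z \<in> closure_pt X y" using dominates_center[OF b] by (simp add: dominates_def)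
  have yV: "y \<in> V" by (rule closure_pt_opn[OF zcl V])
  obtain \<phi> where \<phi>: "p_inv_linear ?K p e \<phi>" "\<And>a. a \<in> local_ring y \<Longrightarrow> \<phi> (eval y a) = eval y (\<Psi> a)"
    using induced_map_exists[OF comp \<Psi>(1) V(1) yV \<Psi>(2)] by blast
  \<comment> \<open>This is needed beyond the center: membership in the restricted stalk asks for
    inducing germs on a whole neighbourhood of the center in the closure of
    \<open>y\<close>.\<close>
  have ind: "induces X p e y z \<Psi> \<phi>" if z: "z \<in> closure_pt X y" for z
    unfolding induces_def
  proof (intro conjI \<phi>(1) allI impI)
    fix U s W t
    assume U: "opn U" "z \<in> U" "s \<in> Sec U" and W: "opn W" "z \<in> W" "t \<in> Sec W"
      and st: "\<Psi> (to_function_field X U s) = to_function_field X W t"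
    have yU: "y \<in> U" "y \<in> W" using closure_pt_opn[OF z] U W by blast+
    show "\<phi> (value_at X y U s) = value_at X y W t"
      using \<phi>(2)[OF local_ringI[OF U(1) yU(1) U(3)]] st
        eval_to_function_field[OF U(1) yU(1) U(3)] eval_to_function_field[OF W(1) yU(2) W(3)] by simp
  qed
  let ?f = "value_at X y V f" and ?g = "value_at X y V g"
  have \<phi>f: "\<phi> ?f = ?g"
    using ind[OF zcl] V f g eq unfolding induces_def by blast
  have c: "?f \<in> carrier ?K" "?g \<in> carrier ?K" using value_closed[OF V(1) yV] f g by auto
  have g0: "?g \<noteq> \<zero>\<^bsub>?K\<^esub>" using val_eq_PInf_iff[OF c(2)] fin by simp
  \<comment> \<open>The induced map kills zero and \<open>?g\<close> is nonzero. So
    \<open>?f\<close> is admissible in the supremum and has finite valuation.\<close>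
  have f0: "?f \<noteq> \<zero>\<^bsub>?K\<^esub>"
    using \<phi>f g0 p_inv_linear_zero[OF is_cring \<phi>(1)] p_ge_2 by auto
  obtain r where r: "w ?f = ereal r" using val_finite[OF c(1) f0] .
  obtain r' where r': "w ?g = ereal r'" using val_finite[OF c(2) g0] .
  have "ereal a < E_quot p e w ?f \<phi>"
    using E_quot_greater_iff[OF p_ge_2 \<Psi>(2), of w ?f r \<phi> r'] r r' \<phi>f gr by simp
  also have "\<dots> \<le> log_discrepancy_map ?K p e w \<phi>"
    unfolding log_discrepancy_map_def
    by (rule Sup_upper) (use c f0 in \<open>auto intro!: exI[of _ ?f] exI[of _ "1::nat"]\<close>)
  also have "\<dots> \<le> log_discrepancy_stalk ?K p w (\<lambda>e. cartier_restrict_stalk X p D y e ?z)"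
  proof -
    have "\<phi> \<in> cartier_restrict X p D y e (V \<inter> closure_pt X y)"
      unfolding cartier_restrict_def cartier_stalk_def using \<phi>(1) ind \<Psi>(1) V(1) by blast
    moreover have "openin (subtopology (top_of X) (closure_pt X y)) (V \<inter> closure_pt X y)"
      using V(1) by (auto simp: openin_subtopology)
    ultimately have "\<phi> \<in> cartier_restrict_stalk X p D y e ?z"
      unfolding cartier_restrict_stalk_def using zcl V(2) by blast
    then show ?thesis
      unfolding log_discrepancy_stalk_def
      by (intro Sup_upper) (use \<Psi>(2) c(1) \<phi>f g0 in blast)
  qed
  finally show ?thesis using comp by (simp add: log_discrepancy_def)
qed (simp add: log_discrepancy_def)

text \<open>Here the germ is extended from \<open>y\<close>, not from the center: only finite and
  infinite valuations are distinguished, so the auxiliary factors need only be nonzero at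
  \<open>y\<close>. The value of \<open>g\<close> is h^n B times that of \<psi>(a), a product of
  nonzero elements; the value of \<open>f\<close> is a multiple of that of \<open>a\<close>, hence
  zero.\<close>

lemma log_discrepancy_greaterD_incompatible:
  assumes b: "(w, y) \<in> beth X" and V: "affine_open X V" "y \<in> V"
    and ncomp: "\<not> uniformly_compatible X D (closure_pt X y)"
  obtains e \<Psi> f g where "\<Psi> \<in> D e V" "1 \<le> e" "f \<in> Sec V" "g \<in> Sec V"
    "\<Psi> (to_function_field X V f) = to_function_field X V g"
    "w (value_at X y V g) \<noteq> \<infinity>" "w (value_at X y V f) = \<infinity>"
proof -
  let ?K = "residue_field X y" and ?L = "function_field X"
  interpret field_valuation ?K w by (rule field_valuation_beth[OF b])
  interpret L: cring ?L by (rule function_field_cring)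
  note oV = affine_opn[OF V(1)]
  have y: "y \<in> points X" by (rule opn_points[OF oV V(2)])
  obtain e U \<psi> a where e: "1 \<le> e" and U: "opn U" "y \<in> U" and \<psi>: "\<psi> \<in> D e U"
    and a: "a \<in> local_ring y" "eval y a = \<zero>\<^bsub>?K\<^esub>" "eval y (\<psi> a) \<noteq> \<zero>\<^bsub>?K\<^esub>"
    by (rule incompatible_witness[OF y ncomp])
  have "p ^ e \<noteq> 0" using p_ge_2 by simp
  then obtain f B where f: "f \<in> Sec V" and B: "B \<in> Sec V" "value_at X y V B \<noteq> \<zero>\<^bsub>?K\<^esub>"
    and fB: "to_function_field X V f = to_function_field X V B [^]\<^bsub>?L\<^esub> (p ^ e) \<otimes>\<^bsub>?L\<^esub> a"
    using clear_denominator[OF V a(1)] by metis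
  obtain h \<Psi> n where h: "h \<in> Sec V" "y \<in> nonvanishing X V h" and \<Psi>: "\<Psi> \<in> D e V"
    "\<And>a. a \<in> carrier ?L \<Longrightarrow> \<Psi> a = to_function_field X V h [^]\<^bsub>?L\<^esub> (n::nat) \<otimes>\<^bsub>?L\<^esub> \<psi> a"
    using affine_extension[OF V U \<psi>] by metis
  have ne: "V \<noteq> {}" "U \<noteq> {}" using V U by auto
  obtain g where g: "g \<in> Sec V" "\<Psi> (to_function_field X V f) = to_function_field X V g"
    by (rule D_sections[OF \<Psi>(1) oV oV ne(1) subset_refl f])
  note loc = local_ringI[OF oV V(2)]
  note ev = eval_to_function_field[OF oV V(2)]
  note \<psi>a = D_local_ring[OF \<psi> U a(1)]
  note hB = local_ring_pow[OF loc[OF h(1)], of n] local_ring_mult[OF loc[OF B(1)] \<psi>a]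
  have "\<psi> (to_function_field X V f) = to_function_field X V B \<otimes>\<^bsub>?L\<^esub> \<psi> a"
    unfolding fB by (rule p_inv_linear_mult[OF D_p_inv_linear[OF \<psi> U(1) ne(2)]
      local_ring_closed[OF loc[OF B(1)]] local_ring_closed[OF a(1)]])
  then have "value_at X y V g = value_at X y V h [^]\<^bsub>?K\<^esub> n \<otimes>\<^bsub>?K\<^esub> (value_at X y V B \<otimes>\<^bsub>?K\<^esub> eval y (\<psi> a))"
    using ev[OF g(1)] \<Psi>(2)[OF local_ring_closed[OF loc[OF f]]] eval_mult[OF hB]
      eval_mult[OF loc[OF B(1)] \<psi>a] eval_pow[OF loc[OF h(1)], of n] ev[OF h(1)] ev[OF B(1)] g(2) by simp
  moreover have h0: "value_at X y V h \<noteq> \<zero>\<^bsub>?K\<^esub>" using h nonvanishing_iff[OF oV] by blast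
  ultimately have "value_at X y V g \<noteq> \<zero>\<^bsub>?K\<^esub>"
    using value_closed[OF oV V(2)] h(1) B eval_closed[OF \<psi>a] a(3) nat_pow_nonzero[OF _ h0, of n]
    by (simp add: integral_iff)
  then have "w (value_at X y V g) \<noteq> \<infinity>"
    using val_eq_PInf_iff value_closed[OF oV V(2) g(1)] by blast
  moreover have "value_at X y V f = \<zero>\<^bsub>?K\<^esub>"
    using ev[OF f] eval_mult[OF local_ring_pow[OF loc[OF B(1)]] a(1)] a(2)
      eval_closed[OF local_ring_pow[OF loc[OF B(1)]]] unfolding fB by simp
  then have "w (value_at X y V f) = \<infinity>" using val_eq_PInf_iff[of "\<zero>\<^bsub>?K\<^esub>"] by simp
  ultimately show ?thesis by (rule that[OF \<Psi>(1) e f g])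
qed

text \<open>A witness \<alpha>, \<phi>, n in the suprema is turned into sections over
  \<open>V\<close>, the iterate becoming one map of degree n e. Unlike in the incompatible case
  finite valuations matter, so the germ is extended from the center, where the extra factor has
  valuation 0.\<close>

lemma log_discrepancy_greaterD_compatible:
  assumes b: "(w, y) \<in> beth X" and V: "affine_open X V" "center X (w, y) \<in> V"
    and comp: "uniformly_compatible X D (closure_pt X y)"
    and gr: "ereal a < log_discrepancy X p D (w, y)"
  obtains e \<Psi> f g where "\<Psi> \<in> D e V" "1 \<le> e" "f \<in> Sec V" "g \<in> Sec V"
    "\<Psi> (to_function_field X V f) = to_function_field X V g"
    "w (value_at X y V g) \<noteq> \<infinity>"
    "ereal (real p ^ e) * w (value_at X y V g) + ereal (a * (real p ^ e - 1)) < w (value_at X y V f)"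
proof -
  let ?K = "residue_field X y" and ?L = "function_field X" and ?z = "center X (w, y)"
  interpret field_valuation ?K w by (rule field_valuation_beth[OF b])
  interpret L: cring ?L by (rule function_field_cring)
  note oV = affine_opn[OF V(1)]
  have dom: "dominates w y ?z" by (rule dominates_center[OF b])
  then have zcl: "?z \<in> closure_pt X y" by (simp add: dominates_def)
  have yV: "y \<in> V" by (rule closure_pt_opn[OF zcl oV V(2)])
  obtain e \<phi> where e: "1 \<le> e" and \<phi>s: "\<phi> \<in> cartier_restrict_stalk X p D y e ?z"
    and gr1: "ereal a < log_discrepancy_map ?K p e w \<phi>"
    using gr comp by (auto simp: log_discrepancy_def log_discrepancy_stalk_def less_Sup_iff)
  obtain \<alpha> n where \<alpha>: "\<alpha> \<in> carrier ?K" "\<alpha> \<noteq> \<zero>\<^bsub>?K\<^esub>" and n: "1 \<le> n"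
    and gr2: "ereal a < E_quot p (n * e) w \<alpha> (\<phi> ^^ n)"
    using gr1 by (auto simp: log_discrepancy_map_def less_Sup_iff)
  obtain U \<psi> where \<phi>: "p_inv_linear ?K p e \<phi>" and U: "opn U" "?z \<in> U" and \<psi>: "\<psi> \<in> D e U"
    and ind: "induces X p e y ?z \<psi> \<phi>"
    using \<phi>s unfolding cartier_restrict_stalk_def cartier_restrict_def cartier_stalk_def by blast
  have e': "1 \<le> n * e" using e n by simp
  \<comment> \<open>The relation \<open>induces\<close> links \<phi> and \<psi> only on the local
    ring at the center, so the induction also carries that the iterates stay in it.\<close>
  have \<phi>_eval: "(\<phi> ^^ k) (eval y c) = eval y ((\<psi> ^^ k) c) \<and> (\<psi> ^^ k) c \<in> local_ring ?z"
    if c: "c \<in> local_ring ?z" for k c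
  proof (induction k)
    case (Suc k)
    let ?c = "(\<psi> ^^ k) c"
    have c1: "?c \<in> local_ring ?z" "\<psi> ?c \<in> local_ring ?z"
      using Suc D_local_ring[OF \<psi> U] by auto
    obtain W s where W: "opn W" "?z \<in> W" "s \<in> Sec W" "?c = to_function_field X W s"
      using c1(1) by (rule local_ringE)
    obtain W' t where W': "opn W'" "?z \<in> W'" "t \<in> Sec W'" "\<psi> ?c = to_function_field X W' t"
      using c1(2) by (rule local_ringE)
    have yW: "y \<in> W" "y \<in> W'" using closure_pt_opn[OF zcl] W W' by blast+
    have "\<phi> (value_at X y W s) = value_at X y W' t"
      using ind W W' unfolding induces_def by metis
    then have "\<phi> (eval y ?c) = eval y (\<psi> ?c)"
      unfolding W'(4) unfolding W(4) eval_to_function_field[OF W(1) yW(1) W(3)]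
        eval_to_function_field[OF W'(1) yW(2) W'(3)] .
    then show ?case using Suc c1(2) by simp
  qed (use c in simp)
  have \<phi>n_closed: "(\<phi> ^^ k) \<beta> \<in> carrier ?K" if "\<beta> \<in> carrier ?K" for k \<beta>
    by (induction k) (use that p_inv_linear_closed[OF \<phi>] in auto)
  obtain a0 where a0: "a0 \<in> local_ring y" "\<alpha> = eval y a0" using eval_surj[OF \<alpha>(1)] .
  \<comment> \<open>The lift \<open>a0\<close> of \<alpha> is only known to lie in the local ring at
    \<open>y\<close>. Clearing denominators over \<open>V\<close> gives an element of the local ring
    at the center, to which \<open>\<phi>_eval\<close> applies.\<close>
  have "p ^ (n * e) \<noteq> 0" using p_ge_2 by simp
  then obtain f B where f: "f \<in> Sec V" and B: "B \<in> Sec V" "value_at X y V B \<noteq> \<zero>\<^bsub>?K\<^esub>"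
    and fB: "to_function_field X V f = to_function_field X V B [^]\<^bsub>?L\<^esub> (p ^ (n * e)) \<otimes>\<^bsub>?L\<^esub> a0"
    using clear_denominator[OF V(1) yV a0(1)] by metis
  have ne: "V \<noteq> {}" "U \<noteq> {}" using V U by auto
  \<comment> \<open>The index n - 1 compensates the successor in \<open>D_funpow\<close>; n is
    positive.\<close>
  obtain \<psi>' where \<psi>': "\<psi>' \<in> D (n * e) U" "\<And>c. c \<in> carrier ?L \<Longrightarrow> \<psi>' c = (\<psi> ^^ n) c"
    using D_funpow[OF \<psi> U(1) ne(2), of "n - 1"] n by auto
  obtain h \<Psi> N where h: "h \<in> Sec V" "?z \<in> nonvanishing X V h" and \<Psi>: "\<Psi> \<in> D (n * e) V"
    "\<And>a. a \<in> carrier ?L \<Longrightarrow> \<Psi> a = to_function_field X V h [^]\<^bsub>?L\<^esub> (N::nat) \<otimes>\<^bsub>?L\<^esub> \<psi>' a"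
    using affine_extension[OF V U \<psi>'(1)] by metis
  obtain g where g: "g \<in> Sec V" "\<Psi> (to_function_field X V f) = to_function_field X V g"
    by (rule D_sections[OF \<Psi>(1) oV oV ne(1) subset_refl f])
  note loc = local_ringI[OF oV yV] and locz = local_ringI[OF oV V(2)]
  note ev = eval_to_function_field[OF oV yV]
  let ?f = "value_at X y V f" and ?g = "value_at X y V g" and ?B = "value_at X y V B"
    and ?h = "value_at X y V h" and ?\<beta> = "(\<phi> ^^ n) \<alpha>"
  have c: "?f \<in> carrier ?K" "?g \<in> carrier ?K" "?B \<in> carrier ?K" "?h \<in> carrier ?K" "?\<beta> \<in> carrier ?K"
    using value_closed[OF oV yV] f g B h \<phi>n_closed[OF \<alpha>(1)] by auto
  have f_eq: "?f = ?B [^]\<^bsub>?K\<^esub> (p ^ (n * e)) \<otimes>\<^bsub>?K\<^esub> \<alpha>"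
    using eval_mult[OF local_ring_pow[OF loc[OF B(1)]] a0(1)] eval_pow[OF loc[OF B(1)]] ev[OF f] ev[OF B(1)]
    unfolding fB a0(2) by simp
  have \<phi>f: "(\<phi> ^^ n) ?f = ?B \<otimes>\<^bsub>?K\<^esub> ?\<beta>"
    unfolding f_eq by (rule funpow_p_inv_linear[OF is_cring \<phi> c(3) \<alpha>(1)])
  have \<psi>f: "(\<psi> ^^ n) (to_function_field X V f) \<in> local_ring y"
    "eval y ((\<psi> ^^ n) (to_function_field X V f)) = (\<phi> ^^ n) ?f"
    using \<phi>_eval[OF locz[OF f], of n] local_ring_specialization[OF zcl] ev[OF f] by auto
  have "?g = ?h [^]\<^bsub>?K\<^esub> N \<otimes>\<^bsub>?K\<^esub> (\<phi> ^^ n) ?f"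
    using ev[OF g(1)] g(2) \<Psi>(2)[OF local_ring_closed[OF loc[OF f]]] \<psi>'(2)[OF local_ring_closed[OF loc[OF f]]]
      eval_mult[OF local_ring_pow[OF loc[OF h(1)], of N] \<psi>f(1)] \<psi>f(2) eval_pow[OF loc[OF h(1)], of N] ev[OF h(1)]
    by simp
  then have g_eq: "?g = ?h [^]\<^bsub>?K\<^esub> N \<otimes>\<^bsub>?K\<^esub> (?B \<otimes>\<^bsub>?K\<^esub> ?\<beta>)" unfolding \<phi>f .
  have "value_at X ?z V h \<noteq> \<zero>\<^bsub>residue_field X ?z\<^esub>" using h nonvanishing_iff[OF oV] by blast
  \<comment> \<open>Domination: a section not vanishing at the center has valuation 0.\<close>
  then have wh: "w ?h = 0"
    using dom oV V(2) h(1) unfolding dominates_def by (metis order_le_less)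
  obtain r where r: "w \<alpha> = ereal r" using val_finite[OF \<alpha>] .
  obtain rB where rB: "w ?B = ereal rB" using val_finite[OF c(3) B(2)] .
  \<comment> \<open>Otherwise the quotient for \<alpha> would be -\<infinity>.\<close>
  have "w ?\<beta> \<noteq> \<infinity>"
    using E_quot_zero[OF p_ge_2 e', of w \<alpha> r "\<phi> ^^ n"] r gr2 by auto
  then obtain r' where r': "w ?\<beta> = ereal r'"
    using val_not_MInf[OF c(5)] by (cases "w ?\<beta>") auto
  \<comment> \<open>The factor \<open>?B\<close> adds rB to the valuation of \<open>?g\<close> and
    p^(n e) rB to that of \<open>?f\<close>, so it cancels in the final inequality.\<close>
  have wg: "w ?g = ereal (rB + r')"
    unfolding g_eq using c val_mult[of "?h [^]\<^bsub>?K\<^esub> N" "?B \<otimes>\<^bsub>?K\<^esub> ?\<beta>"] val_mult[of ?B ?\<beta>] val_pow_zero[OF c(4) wh] rB r'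
    by simp
  have wf: "w ?f = ereal (real p ^ (n * e) * rB + r)"
    unfolding f_eq using c \<alpha>(1) val_mult[of "?B [^]\<^bsub>?K\<^esub> (p ^ (n * e))" \<alpha>] val_pow[OF c(3)] rB r
    by simp
  have "real p ^ (n * e) * r' + a * (real p ^ (n * e) - 1) < r"
    using gr2 E_quot_greater_iff[OF p_ge_2 e', of w \<alpha> r "\<phi> ^^ n" r'] r r' by simp
  then show ?thesis
    by (intro that[OF \<Psi>(1) e' f g]) (simp_all add: wg wf algebra_simps)
qed

section \<open>Openness of the inequalities and the conclusion\<close>

lemma semival_condition_open:
  assumes V: "opn V" and q: "0 < (q::real)" and f: "f \<in> Sec V" and g: "g \<in> Sec V"
  shows "openin (beth_affine_topology X V)
    {\<zeta> \<in> beth_open X V. semival_apply X \<zeta> V g \<noteq> \<infinity> \<and>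
       ereal q * semival_apply X \<zeta> V g + ereal c < semival_apply X \<zeta> V f}"
proof -
  let ?O = "\<lambda>f S. {\<zeta> \<in> beth_open X V. semival_apply X \<zeta> V f \<in> S}"
  have O: "openin (beth_affine_topology X V) (?O f S)" if "f \<in> Sec V" "open S" for f S
    unfolding beth_affine_topology_def by (rule topology_generated_by_Basis) (use that in blast)
  \<comment> \<open>The home lies in \<open>V\<close> as a generization of the center, so the value
    of \<open>g\<close> there is an element of the residue field. Excluding -\<infinity> makes a
    real upper bound force a real value.\<close>
  have nMInf: "semival_apply X \<zeta> V g \<noteq> -\<infinity>" if z: "\<zeta> \<in> beth_open X V" for \<zeta>
  proof -
    obtain w y where \<zeta>: "\<zeta> = (w, y)" by force
    have b: "(w, y) \<in> beth X" "center X (w, y) \<in> V" using z \<zeta> by (auto simp: beth_open_def)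
    interpret field_valuation "residue_field X y" w by (rule field_valuation_beth[OF b(1)])
    have "y \<in> V"
      using dominates_center[OF b(1)] closure_pt_opn[OF _ V b(2)] by (simp add: dominates_def)
    then show ?thesis
      using val_not_MInf[OF value_closed[OF V _ g]] \<zeta> by (simp add: semival_apply_def)
  qed
  \<comment> \<open>With x and y the values of \<open>g\<close> and \<open>f\<close>: x is finite
    and q x + c < y iff x < r and q r + c < y for some real r. Each r gives an intersection of two
    subbasic open sets.\<close>
  have "{\<zeta> \<in> beth_open X V. semival_apply X \<zeta> V g \<noteq> \<infinity> \<and>
       ereal q * semival_apply X \<zeta> V g + ereal c < semival_apply X \<zeta> V f} =
    (\<Union>r::real. ?O g {..<ereal r} \<inter> ?O f {ereal (q * r + c)<..})" (is "?A = ?B")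
  proof (intro equalityI subsetI)
    fix \<zeta> assume \<zeta>: "\<zeta> \<in> ?A"
    then obtain s where s: "semival_apply X \<zeta> V g = ereal s"
      using nMInf by (cases "semival_apply X \<zeta> V g") auto
    then have "ereal (q * s + c) < semival_apply X \<zeta> V f" using \<zeta> by simp
    then obtain m where m: "ereal (q * s + c) < ereal m" "ereal m < semival_apply X \<zeta> V f"
      using ereal_dense2 by blast
    \<comment> \<open>The solution of q r + c = m, where the real m lies strictly between the two
      sides; q > 0 turns this into s < r.\<close>
    let ?r = "(m - c) / q"
    have "s < ?r" using m(1) q by (simp add: pos_less_divide_eq algebra_simps)
    moreover have "q * ?r + c = m" using q by simp
    ultimately have "\<zeta> \<in> ?O g {..<ereal ?r} \<inter> ?O f {ereal (q * ?r + c)<..}"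
      using \<zeta> s m(2) by simp
    then show "\<zeta> \<in> ?B" by blast
  next
    fix \<zeta> assume "\<zeta> \<in> ?B"
    then obtain r :: real where \<zeta>: "\<zeta> \<in> beth_open X V" "semival_apply X \<zeta> V g < ereal r"
        "ereal (q * r + c) < semival_apply X \<zeta> V f" by auto
    then obtain s where s: "semival_apply X \<zeta> V g = ereal s"
      using nMInf by (cases "semival_apply X \<zeta> V g") auto
    have "q * s + c < q * r + c" using \<zeta>(2) s q by simp
    then have "ereal (q * s + c) < semival_apply X \<zeta> V f"
      using \<zeta>(3) by (meson ereal_less_eq(3) le_less_trans less_imp_le)
    then show "\<zeta> \<in> ?A" using \<zeta>(1) s by simp
  qed
  also have "openin (beth_affine_topology X V) ?B"
    using openin_Int[OF O[OF g open_lessThan] O[OF f open_greaterThan]]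
    by (intro openin_Union ballI) (elim imageE, simp only:)
  finally show ?thesis .
qed

text \<open>The index set on the right depends on neither the home nor the center of \<zeta>, and
  the inequality does not mention compatibility: the same family detects compatible and incompatible
  homes.\<close>

lemma log_discrepancy_greater_affine:
  assumes V: "affine_open X V"
  shows "{\<zeta> \<in> beth X. ereal a < log_discrepancy X p D \<zeta>} \<inter> beth_open X V =
    (\<Union>(e, \<Psi>, f, g) \<in> {(e, \<Psi>, f, g). \<Psi> \<in> D e V \<and> 1 \<le> e \<and> f \<in> Sec V \<and> g \<in> Sec V \<and>
         \<Psi> (to_function_field X V f) = to_function_field X V g}.
       {\<zeta> \<in> beth_open X V. semival_apply X \<zeta> V g \<noteq> \<infinity> \<and>
         ereal (real p ^ e) * semival_apply X \<zeta> V g + ereal (a * (real p ^ e - 1)) < semival_apply X \<zeta> V f})"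
    (is "?A = ?B")
proof (intro equalityI subsetI)
  note oV = affine_opn[OF V]
  fix \<zeta> assume \<zeta>: "\<zeta> \<in> ?A"
  obtain w y where wy: "\<zeta> = (w, y)" by force
  have b: "(w, y) \<in> beth X" "center X (w, y) \<in> V" and gr: "ereal a < log_discrepancy X p D (w, y)"
    using \<zeta> wy by (auto simp: beth_open_def)
  obtain e \<Psi> f g where P: "\<Psi> \<in> D e V" "1 \<le> e" "f \<in> Sec V" "g \<in> Sec V"
    "\<Psi> (to_function_field X V f) = to_function_field X V g"
    "w (value_at X y V g) \<noteq> \<infinity>"
    "ereal (real p ^ e) * w (value_at X y V g) + ereal (a * (real p ^ e - 1)) < w (value_at X y V f)"
  proof (cases "uniformly_compatible X D (closure_pt X y)")
    case True
    then show ?thesis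
      using log_discrepancy_greaterD_compatible[OF b(1) V b(2) _ gr] that by metis
  next
    case False
    have "y \<in> V"
      using dominates_center[OF b(1)] closure_pt_opn[OF _ oV b(2)] by (simp add: dominates_def)
    then obtain e \<Psi> f g where Q: "\<Psi> \<in> D e V" "1 \<le> e" "f \<in> Sec V" "g \<in> Sec V"
      "\<Psi> (to_function_field X V f) = to_function_field X V g"
      "w (value_at X y V g) \<noteq> \<infinity>" "w (value_at X y V f) = \<infinity>"
      using log_discrepancy_greaterD_incompatible[OF b(1) V _ False] by metis
    show ?thesis
      \<comment> \<open>The left side is finite or -\<infinity>, while the valuation of
        \<open>f\<close> is \<infinity>, so the strict inequality holds for every a.\<close>
      by (rule that[OF Q(1-6)]) (use Q(6,7) in \<open>cases "w (value_at X y V g)"; simp\<close>)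
  qed
  have "\<zeta> \<in> {\<zeta> \<in> beth_open X V. semival_apply X \<zeta> V g \<noteq> \<infinity> \<and>
         ereal (real p ^ e) * semival_apply X \<zeta> V g + ereal (a * (real p ^ e - 1)) < semival_apply X \<zeta> V f}"
    using P(6,7) \<zeta> by (simp add: wy semival_apply_def)
  then show "\<zeta> \<in> ?B" using P(1-5) by blast
next
  note oV = affine_opn[OF V]
  fix \<zeta> assume "\<zeta> \<in> ?B"
  then obtain e \<Psi> f g where P: "\<Psi> \<in> D e V" "1 \<le> e" "f \<in> Sec V" "g \<in> Sec V"
    "\<Psi> (to_function_field X V f) = to_function_field X V g" and \<zeta>: "\<zeta> \<in> beth_open X V"
    "semival_apply X \<zeta> V g \<noteq> \<infinity>"
    "ereal (real p ^ e) * semival_apply X \<zeta> V g + ereal (a * (real p ^ e - 1)) < semival_apply X \<zeta> V f"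
    by blast
  obtain w y where wy: "\<zeta> = (w, y)" by force
  have "(w, y) \<in> beth X" "center X (w, y) \<in> V" using \<zeta>(1) wy by (auto simp: beth_open_def)
  then have "ereal a < log_discrepancy X p D (w, y)"
    using log_discrepancy_greaterI[OF _ oV _ P] \<zeta>(2,3) by (simp add: wy semival_apply_def)
  then show "\<zeta> \<in> ?A" using \<zeta>(1) wy by (simp add: beth_open_def)
qed

lemma log_discrepancy_lsc:
  "openin (beth_topology X) {\<zeta> \<in> beth X. ereal a < log_discrepancy X p D \<zeta>}"
  unfolding openin_beth_topology
proof (intro conjI allI impI)
  fix V assume V: "affine_open X V"
  have "0 < p" using p_ge_2 by simp
  then show "openin (beth_affine_topology X V)
      ({\<zeta> \<in> beth X. ereal a < log_discrepancy X p D \<zeta>} \<inter> beth_open X V)"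
    unfolding log_discrepancy_greater_affine[OF V]
    by (intro openin_Union) (auto intro!: semival_condition_open[OF affine_opn[OF V]])
qed blast

end

theorem theorem6p4:
  fixes X :: "('a, 'r) ringed_space"
    and p :: nat
    and D :: "nat \<Rightarrow> 'a set \<Rightarrow> (('a, 'r) germ \<Rightarrow> ('a, 'r) germ) set"
  assumes "separated_scheme X"
    and "noetherian_scheme X"
    and "integral_scheme X"
    and "has_prime_char X p"
    and "cartier_subalgebra X p D"
  shows "\<forall>a::real. openin (beth_topology X) {\<zeta> \<in> beth X. ereal a < log_discrepancy X p D \<zeta>}"
proof -
  have "scheme X" using assms(1) by (simp add: separated_scheme_def)
  moreover from this have "locally_ringed_space X" by (simp add: scheme_def)
  ultimately interpret cartier_scheme X p D
    using assms by unfold_locales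
  show ?thesis using log_discrepancy_lsc by blast
qed

end
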